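(* Let $X$ be a complex Banach space and let $T\in L(X)$. The following statements are equivalent. (i) $T$ satisfies property $(gw_{\pi_{00}})$; (ii) $T$ satisfies property $(w_{\pi_{00}})$ and $\pi_{0}(T)=p_{0}^a(T)$.
   Context: $L(X)$ is the algebra of bounded linear operators on the complex Banach space $X$; $N(S)$ and $R(S)$ denote the kernel and range of $S$; $\sigma(T)$ is the spectrum and $\sigma_a(T)$ the approximate point spectrum of $T$; $\mbox{iso}\,A$ is the set of isolated points of $A\subset\mathbb{C}$. $S\in L(X)$ is upper semi-Fredholm if $R(S)$ is closed and $\dim N(S)<\infty$. $S$ is upper semi-B-Fredholm if for some integer $n\ge 0$ the space $R(S^n)$ is closed and the restriction $S_{[n]}:R(S^n)\to R(S^n)$ of $S$ is upper semi-Fredholm. The ascent of $S$ is $\mbox{asc}(S)=\inf\{n\ge0: N(S^n)=N(S^{n+1})\}$. $S$ is left Drazin invertible if $p=\mbox{asc}(S)<\infty$ and $R(S^{p+1})$ is closed. The sets $\sigma_{uf}(T)$, $\sigma_{ubf}(T)$, $\sigma_{ld}(T)$ consist of the $\lambda\in\mathbb{C}$ such that $T-\lambda I$ is not, respectively, upper semi-Fredholm, upper semi-B-Fredholm, left Drazin invertible. The set of left poles of $T$ is $p_0^a(T)=\sigma_a(T)\setminus\sigma_{ld}(T)$. $\sigma_p(T)$ is the set of eigenvalues of $T$, and $\sigma_p^f(T)$ the set of eigenvalues of finite multiplicity ($0<\dim N(T-\lambda I)<\infty$). Put $\pi_0(T)=\mbox{iso}\,\sigma(T)\cap\sigma_p(T)$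 and $\pi_{00}(T)=\mbox{iso}\,\sigma(T)\cap\sigma_p^f(T)$. $T$ satisfies: property $(w_{\pi_{00}})$ if $\sigma_a(T)\setminus\sigma_{uf}(T)=\pi_{00}(T)$; property $(gw_{\pi_{00}})$ if $\sigma_a(T)\setminus\sigma_{ubf}(T)=\pi_0(T)$. *)

theory Defs
  imports "HOL-Complex_Analysis.Complex_Analysis"
begin

text \<open>
  The class \<open>banach\<close> is about real scalars.  A complex Banach space is a (real) Banach space
  whose real scalar multiplication extends to a complex one for which the norm is absolutely
  homogeneous.
\<close>

class complex_banach = banach +
  fixes scaleC :: "complex \<Rightarrow> 'a \<Rightarrow> 'a"  (infixr \<open>*\<^sub>C\<close> 75)
  assumes scaleC_add_right: "a *\<^sub>C (x + y) = a *\<^sub>C x + a *\<^sub>C y"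
    and scaleC_add_left: "(a + b) *\<^sub>C x = a *\<^sub>C x + b *\<^sub>C x"
    and scaleC_scaleC: "a *\<^sub>C (b *\<^sub>C x) = (a * b) *\<^sub>C x"
    and scaleC_of_real: "complex_of_real r *\<^sub>C x = r *\<^sub>R x"
    and norm_scaleC: "norm (a *\<^sub>C x) = cmod a * norm x"

global_interpretation complex_vector:
  vector_space "scaleC :: complex \<Rightarrow> 'a \<Rightarrow> 'a::complex_banach"
proof
  show "1 *\<^sub>C x = x" for x :: 'a
    using scaleC_of_real [of 1 x] by simp
qed (fact scaleC_add_right scaleC_add_left scaleC_scaleC)+

instantiation complex :: complex_banach
begin

definition scaleC_complex :: "complex \<Rightarrow> complex \<Rightarrow> complex"
  where "scaleC_complex a x = a * x"

instance
  by standard (simp_all add: scaleC_complex_def algebra_simps norm_mult scaleR_conv_of_real)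

end

text \<open>Membership in the algebra $L(X)$.\<close>

definition bounded_clinear :: "('a::complex_banach \<Rightarrow> 'a) \<Rightarrow> bool"
  where "bounded_clinear S \<longleftrightarrow> bounded_linear S \<and> (\<forall>c x. S (c *\<^sub>C x) = c *\<^sub>C S x)"

definition null_space :: "('a::complex_banach \<Rightarrow> 'a) \<Rightarrow> 'a set"
  where "null_space S = {x. S x = 0}"

text \<open>
  The dimension \<open>complex_vector.dim\<close> of the library is \<open>0\<close> on infinite-dimensional spaces, so
  finiteness of the dimension is expressed by a finite spanning set.
\<close>

definition cfinite_dim :: "'a::complex_banach set \<Rightarrow> bool"
  where "cfinite_dim V \<longleftrightarrow> (\<exists>B. finite B \<and> V = complex_vector.span B)"

definition shift :: "('a::complex_banach \<Rightarrow> 'a) \<Rightarrow> complex \<Rightarrow> 'a \<Rightarrow> 'a"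
  where "shift T \<mu> = (\<lambda>x. T x - \<mu> *\<^sub>C x)"

definition spectrum :: "('a::complex_banach \<Rightarrow> 'a) \<Rightarrow> complex set"
  where "spectrum T =
    {\<mu>. \<not> (\<exists>R. bounded_clinear R \<and> R \<circ> shift T \<mu> = id \<and> shift T \<mu> \<circ> R = id)}"

definition approx_point_spectrum :: "('a::complex_banach \<Rightarrow> 'a) \<Rightarrow> complex set"
  where "approx_point_spectrum T =
    {\<mu>. \<exists>x :: nat \<Rightarrow> 'a. (\<forall>n. norm (x n) = 1) \<and> (\<lambda>n. shift T \<mu> (x n)) \<longlonglongrightarrow> 0}"

definition point_spectrum :: "('a::complex_banach \<Rightarrow> 'a) \<Rightarrow> complex set"
  where "point_spectrum T = {\<mu>. \<exists>x. x \<noteq> 0 \<and> T x = \<mu> *\<^sub>C x}"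

definition point_spectrum_finite :: "('a::complex_banach \<Rightarrow> 'a) \<Rightarrow> complex set"
  where "point_spectrum_finite T =
    {\<mu> \<in> point_spectrum T. cfinite_dim (null_space (shift T \<mu>))}"

text \<open>
  Upper semi-Fredholmness of the restriction $S : M \to M$ of \<open>S\<close> to an \<open>S\<close>-invariant subspace
  \<open>M\<close>; closedness of the range is relative to \<open>M\<close>.
\<close>

definition upper_semi_fredholm_on :: "'a set \<Rightarrow> ('a::complex_banach \<Rightarrow> 'a) \<Rightarrow> bool"
  where "upper_semi_fredholm_on M S \<longleftrightarrow>
    closedin (top_of_set M) (S ` M) \<and> cfinite_dim {x \<in> M. S x = 0}"

definition upper_semi_fredholm :: "('a::complex_banach \<Rightarrow> 'a) \<Rightarrow> bool"
  where "upper_semi_fredholm S \<longleftrightarrow> closed (range S) \<and> cfinite_dim (null_space S)"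

definition upper_semi_b_fredholm :: "('a::complex_banach \<Rightarrow> 'a) \<Rightarrow> bool"
  where "upper_semi_b_fredholm S \<longleftrightarrow>
    (\<exists>n. closed (range (S ^^ n)) \<and> upper_semi_fredholm_on (range (S ^^ n)) S)"

text \<open>The infimum of the empty set is \<open>\<infinity>\<close> in \<^typ>\<open>enat\<close>.\<close>

definition ascent :: "('a::complex_banach \<Rightarrow> 'a) \<Rightarrow> enat"
  where "ascent S = (INF n \<in> {n. null_space (S ^^ n) = null_space (S ^^ Suc n)}. enat n)"

definition left_drazin_invertible :: "('a::complex_banach \<Rightarrow> 'a) \<Rightarrow> bool"
  where "left_drazin_invertible S \<longleftrightarrow>
    (\<exists>p. ascent S = enat p \<and> closed (range (S ^^ Suc p)))"

definition usf_spectrum :: "('a::complex_banach \<Rightarrow> 'a) \<Rightarrow> complex set"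
  where "usf_spectrum T = {\<mu>. \<not> upper_semi_fredholm (shift T \<mu>)}"

definition usbf_spectrum :: "('a::complex_banach \<Rightarrow> 'a) \<Rightarrow> complex set"
  where "usbf_spectrum T = {\<mu>. \<not> upper_semi_b_fredholm (shift T \<mu>)}"

definition left_drazin_spectrum :: "('a::complex_banach \<Rightarrow> 'a) \<Rightarrow> complex set"
  where "left_drazin_spectrum T = {\<mu>. \<not> left_drazin_invertible (shift T \<mu>)}"

definition left_poles :: "('a::complex_banach \<Rightarrow> 'a) \<Rightarrow> complex set"
  where "left_poles T = approx_point_spectrum T - left_drazin_spectrum T"

definition pi_0 :: "('a::complex_banach \<Rightarrow> 'a) \<Rightarrow> complex set"
  where "pi_0 T = isolated_points_of (spectrum T) \<inter> point_spectrum T"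

definition pi_00 :: "('a::complex_banach \<Rightarrow> 'a) \<Rightarrow> complex set"
  where "pi_00 T = isolated_points_of (spectrum T) \<inter> point_spectrum_finite T"

definition property_w_pi_00 :: "('a::complex_banach \<Rightarrow> 'a) \<Rightarrow> bool"
  where "property_w_pi_00 T \<longleftrightarrow> approx_point_spectrum T - usf_spectrum T = pi_00 T"

definition property_gw_pi_00 :: "('a::complex_banach \<Rightarrow> 'a) \<Rightarrow> bool"
  where "property_gw_pi_00 T \<longleftrightarrow> approx_point_spectrum T - usbf_spectrum T = pi_0 T"

end

theory Submission
  imports Defs
begin

text \<open>
  The properties differ in replacing upper semi-Fredholm by upper semi-B-Fredholm operators, and
  they are compared through the left Drazin invertible operators, which are upper semi-B-Fredholm.
  Two facts about an upper semi-B-Fredholm operator \<open>S\<close> carry the proof.  If its kernel is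
  finite-dimensional, it is upper semi-Fredholm
  (\<open>upper_semi_fredholm_if_finite_nullity\<close>).  And \<open>S\<close> is left Drazin invertible unless every
  small \<open>\<mu> \<noteq> 0\<close> is an eigenvalue of \<open>S\<close> for which \<open>shift S \<mu>\<close> is upper semi-Fredholm
  (\<open>upper_semi_b_fredholm_dichotomy\<close>).

  The exceptional case of the dichotomy is excluded by each of the two sides of the equivalence.
  Under \<open>property_gw_pi_00\<close> the points of the approximate point spectrum outside the upper
  semi-B-Fredholm spectrum are isolated in the spectrum, so none of them has a neighbourhood
  consisting of eigenvalues.  Under \<open>property_w_pi_00\<close>, every point of the punctured disc belongs to the approximate point spectrum but not to the upper semi-Fredholm
  spectrum; it would have to be isolated in the spectrum, although the disc consists of
  eigenvalues.  Hence on either side the left poles are exactly the points of the approximate point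
  spectrum outside the upper semi-B-Fredholm spectrum.

  For the dichotomy, let \<open>d\<close> be so large that the ranges of \<open>S ^^ m\<close> are closed for \<open>m \<ge> d\<close> and meet
  the kernel in the same subspace \<open>N\<close> of finite dimension.  The intersection \<open>Y\<close> of all these
  ranges is closed, contains \<open>N\<close>, and \<open>S\<close> maps it onto itself.  If \<open>N\<close> is zero, the ascent is
  finite.  Otherwise surjectivity on \<open>Y\<close> continues the elements of \<open>N\<close> to eigenvectors for small
  \<open>\<mu>\<close>, and these exhaust the eigenspaces, which are therefore finite-dimensional.  Moreover \<open>S\<close> is
  bounded below on \<open>range (S ^^ d)\<close> modulo \<open>Y\<close>, so \<open>shift S \<mu>\<close> has closed range on
  \<open>range (S ^^ d)\<close> and then on the whole space.
\<close>

section \<open>Successive approximation and the open mapping theorem\<close>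

text \<open>
  Repeating an approximate solution on the remaining error halves the error each time, so that the
  corrections form a geometric series. Three uses: the second half of the open mapping theorem, its
  converse, and the stability of surjectivity under a small shift; the set \<open>W\<close> is the place where
  the errors live.
\<close>

lemma exact_solution_of_approximate:
  fixes f :: "'a::banach \<Rightarrow> 'b::real_normed_vector"
  assumes f: "bounded_linear f" and V: "subspace V" "closed V" and "C \<ge> 0"
    and step: "\<And>y. y \<in> W \<Longrightarrow>
      \<exists>x\<in>V. norm x \<le> C * norm y \<and> y - f x \<in> W \<and> norm (y - f x) \<le> norm y / 2"
    and y: "y \<in> W"
  shows "\<exists>x\<in>V. f x = y \<and> norm x \<le> 2 * C * norm y"
proof -
  interpret f: bounded_linear f by fact
  obtain \<phi> where \<phi>: "\<phi> y \<in> V" "norm (\<phi> y) \<le> C * norm y" "y - f (\<phi> y) \<in> W"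
    "norm (y - f (\<phi> y)) \<le> norm y / 2" if "y \<in> W" for y
    using step by metis
  define r where "r n = ((\<lambda>z. z - f (\<phi> z)) ^^ n) y" for n
  have r0: "r 0 = y" and rSuc: "r (Suc n) = r n - f (\<phi> (r n))" for n
    by (simp_all add: r_def)
  have rW: "r n \<in> W" for n
    by (induction n) (auto simp: r0 rSuc y \<phi>)
  have rbound: "norm (r n) \<le> norm y * (1/2) ^ n" for n
  proof (induction n)
    case (Suc n)
    show ?case using \<phi>(4)[OF rW[of n]] Suc by (simp add: rSuc)
  qed (simp add: r0)
  have xbound: "norm (\<phi> (r n)) \<le> C * norm y * (1/2) ^ n" for n
    using \<phi>(2)[OF rW[of n]] mult_left_mono[OF rbound[of n] \<open>C \<ge> 0\<close>] by (simp add: mult.assoc)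
  have geo: "(\<lambda>n. C * norm y * (1/2) ^ n) sums (C * norm y * 2)"
    using sums_mult[OF geometric_sums[of "1/2::real"], of "C * norm y"] by simp
  have sumn: "summable (\<lambda>n. norm (\<phi> (r n)))"
    by (rule summable_comparison_test'[OF sums_summable[OF geo], of 0]) (simp add: xbound)
  hence sum: "summable (\<lambda>n. \<phi> (r n))" by (rule summable_norm_cancel)
  define x where "x = (\<Sum>n. \<phi> (r n))"
  have lim: "(\<lambda>n. \<Sum>i<n. \<phi> (r i)) \<longlonglongrightarrow> x"
    using summable_LIMSEQ[OF sum] by (simp add: x_def)
  have "x \<in> V"
    by (rule closed_sequentially[OF V(2) _ lim]) (auto intro!: subspace_sum V(1) \<phi> rW)
  moreover have "norm x \<le> 2 * C * norm y"
  proof -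
    have "norm x \<le> (\<Sum>n. norm (\<phi> (r n)))" unfolding x_def by (rule summable_norm[OF sumn])
    also have "\<dots> \<le> (\<Sum>n. C * norm y * (1/2) ^ n)"
      by (rule suminf_le[OF xbound sumn sums_summable[OF geo]])
    finally show ?thesis using sums_unique[OF geo] by simp
  qed
  moreover have "f x = y"
  proof -
    have partial: "f (\<Sum>i<n. \<phi> (r i)) = y - r n" for n
      by (induction n) (simp_all add: r0 rSuc f.add f.zero)
    have "(\<lambda>n. norm y * (1/2::real) ^ n) \<longlonglongrightarrow> norm y * 0"
      by (intro tendsto_intros LIMSEQ_realpow_zero) auto
    hence "(\<lambda>n. norm y * (1/2::real) ^ n) \<longlonglongrightarrow> 0" by simp
    hence "r \<longlonglongrightarrow> 0"
      by (rule Lim_null_comparison[rotated]) (simp add: rbound)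
    hence "(\<lambda>n. y - r n) \<longlonglongrightarrow> y" using tendsto_diff[of "\<lambda>_. y" y _ r 0] by simp
    moreover have "(\<lambda>n. y - r n) \<longlonglongrightarrow> f x"
      using f.tendsto[OF lim] by (simp add: partial)
    ultimately show ?thesis using LIMSEQ_unique by blast
  qed
  ultimately show ?thesis by blast
qed

lemma subspace_image_bounded_linear:
  "bounded_linear f \<Longrightarrow> subspace V \<Longrightarrow> subspace (f ` V)"
  by (simp add: bounded_linear.linear linear_subspace_image)

text \<open>
  The Baire half of the open mapping theorem. The closed image is covered by the closures of the
  images of the balls of integer radius, and Baire's theorem gives one of these closures an interior
  point relative to the image.
\<close>

lemma image_near_all_of_closed_image:
  fixes f :: "'a::banach \<Rightarrow> 'b::banach"
  assumes f: "bounded_linear f" and V: "subspace V" and W: "closed (f ` V)"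
  obtains C where "C \<ge> 0"
    "\<And>y. y \<in> f ` V \<Longrightarrow> \<exists>x\<in>V. norm x \<le> C * norm y \<and> norm (y - f x) \<le> norm y / 2"
proof -
  interpret f: bounded_linear f by fact
  define W where "W = f ` V"
  have Ws: "subspace W" unfolding W_def by (rule subspace_image_bounded_linear) fact+
  define A where "A n = closure (f ` (V \<inter> cball 0 (real n)))" for n
  have AW: "A n \<subseteq> W" for n unfolding A_def W_def by (rule closure_minimal) (use W in auto)
  have cover: "\<Union>(range A) = W"
  proof
    show "\<Union>(range A) \<subseteq> W" using AW by blast
    show "W \<subseteq> \<Union>(range A)"
    proof
      fix y assume "y \<in> W"
      then obtain x where x: "x \<in> V" "y = f x" by (auto simp: W_def)
      obtain n where "norm x \<le> real n" using real_arch_simple by blast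
      hence "y \<in> A n" unfolding A_def using x by (intro subsetD[OF closure_subset]) auto
      thus "y \<in> \<Union>(range A)" by blast
    qed
  qed
  have "\<exists>n. (top_of_set W) interior_of (A n) \<noteq> {}"
  proof (rule ccontr)
    assume none: "\<not> ?thesis"
    have "(top_of_set W) interior_of \<Union>(range A) = {}"
    proof (rule Baire_category_alt)
      show "completely_metrizable_space (top_of_set W) \<or>
          locally_compact_space (top_of_set W) \<and> regular_space (top_of_set W)"
        using W unfolding W_def
        by (simp add: completely_metrizable_space_closedin completely_metrizable_space_euclidean)
      fix T assume "T \<in> range A"
      then show "closedin (top_of_set W) T \<and> (top_of_set W) interior_of T = {}"
        using none AW by (auto simp: A_def intro!: closed_subset)
    qed simp
    moreover have "(top_of_set W) interior_of W = W"
      using interior_of_topspace[of "top_of_set W"] by simp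
    ultimately show False using cover subspace_0[OF Ws] by auto
  qed
  then obtain n w0 where w0: "w0 \<in> (top_of_set W) interior_of (A n)" by blast
  then obtain U where U: "openin (top_of_set W) U" "w0 \<in> U" "U \<subseteq> A n"
    by (auto simp: interior_of_def)
  then obtain \<delta> where \<delta>: "\<delta> > 0" "ball w0 \<delta> \<inter> W \<subseteq> A n"
    by (meson openin_contains_ball order_trans)
  have w0A: "w0 \<in> A n" and w0W: "w0 \<in> W" using U AW by blast+
  \<comment> \<open>Subtracting approximations of \<open>w0\<close> moves the ball to the origin.\<close>
  have small: "\<exists>x\<in>V. norm x \<le> 2 * real n \<and> norm (y - f x) < \<delta> / 4" if "y \<in> W" "norm y < \<delta>" for y
  proof -
    have "w0 + y \<in> A n" using that \<delta> subspace_add[OF Ws w0W] by (auto simp: dist_norm)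
    then obtain u where u: "u \<in> V" "norm u \<le> n" "norm (f u - (w0 + y)) < \<delta> / 8"
      using \<open>\<delta> > 0\<close> unfolding A_def closure_approachable
      by (auto simp: dist_norm dest!: spec[of _ "\<delta>/8"])
    obtain v where v: "v \<in> V" "norm v \<le> n" "norm (f v - w0) < \<delta> / 8"
      using \<open>\<delta> > 0\<close> w0A unfolding A_def closure_approachable
      by (auto simp: dist_norm dest!: spec[of _ "\<delta>/8"])
    have "norm (y - f (u - v)) = norm ((f v - w0) - (f u - (w0 + y)))"
      by (simp add: f.diff algebra_simps)
    also have "\<dots> < \<delta> / 4" using norm_triangle_ineq4[of "f v - w0" "f u - (w0 + y)"] u v by simp
    finally show ?thesis
      using u v norm_triangle_ineq4[of u v] subspace_diff[OF V] by (intro bexI[of _ "u - v"]) auto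
  qed
  show thesis
  proof (rule that[of "4 * real n / \<delta>"])
    show "0 \<le> 4 * real n / \<delta>" using \<open>\<delta> > 0\<close> by simp
    fix y assume "y \<in> f ` V"
    hence yW: "y \<in> W" by (simp add: W_def)
    show "\<exists>x\<in>V. norm x \<le> 4 * real n / \<delta> * norm y \<and> norm (y - f x) \<le> norm y / 2"
    proof (cases "y = 0")
      case True
      then show ?thesis using subspace_0[OF V] by (intro bexI[of _ 0]) (auto simp: f.zero)
    next
      case False
      define t where "t = \<delta> / (2 * norm y)"
      have t: "t > 0" using False \<open>\<delta> > 0\<close> by (simp add: t_def)
      have "norm (t *\<^sub>R y) < \<delta>" using False \<open>\<delta> > 0\<close> by (simp add: t_def)
      then obtain x where x: "x \<in> V" "norm x \<le> 2 * real n" "norm (t *\<^sub>R y - f x) < \<delta> / 4"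
        using small[of "t *\<^sub>R y"] subspace_scale[OF Ws yW] by blast
      have "y - f ((1/t) *\<^sub>R x) = (1/t) *\<^sub>R (t *\<^sub>R y - f x)"
        using t by (simp add: f.scaleR scaleR_diff_right)
      hence "norm (y - f ((1/t) *\<^sub>R x)) = (1/t) * norm (t *\<^sub>R y - f x)" using t by simp
      also have "\<dots> \<le> (1/t) * (\<delta> / 4)" using t x by (intro mult_left_mono) auto
      also have "\<dots> = norm y / 2" using False \<open>\<delta> > 0\<close> by (simp add: t_def)
      finally have 1: "norm (y - f ((1/t) *\<^sub>R x)) \<le> norm y / 2" .
      have "norm ((1/t) *\<^sub>R x) \<le> (1/t) * (2 * real n)"
        using t mult_left_mono[OF x(2), of "1/t"] by simp
      also have "\<dots> = 4 * real n / \<delta> * norm y" using False \<open>\<delta> > 0\<close> by (simp add: t_def)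
      finally show ?thesis using 1 subspace_scale[OF V x(1)] by blast
    qed
  qed
qed

text \<open>
  The open mapping theorem as a bound on preimages, for the restriction to a closed subspace. The
  subspace matters: the theorem is applied to ranges of powers and to their intersection.
\<close>

lemma open_mapping_closed_subspace:
  fixes f :: "'a::banach \<Rightarrow> 'b::banach"
  assumes f: "bounded_linear f" and V: "subspace V" "closed V" and W: "closed (f ` V)"
  obtains C where "C \<ge> 0" "\<And>y. y \<in> f ` V \<Longrightarrow> \<exists>x\<in>V. f x = y \<and> norm x \<le> C * norm y"
proof -
  obtain C where C: "C \<ge> 0"
    "\<And>y. y \<in> f ` V \<Longrightarrow> \<exists>x\<in>V. norm x \<le> C * norm y \<and> norm (y - f x) \<le> norm y / 2"
    using image_near_all_of_closed_image[OF f V(1) W] by blast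
  have Ws: "subspace (f ` V)" by (rule subspace_image_bounded_linear) fact+
  show thesis
  proof (rule that[of "2 * C"])
    show "0 \<le> 2 * C" using C by simp
    fix y assume y: "y \<in> f ` V"
    show "\<exists>x\<in>V. f x = y \<and> norm x \<le> 2 * C * norm y"
    proof (rule exact_solution_of_approximate[OF f V C(1) _ y])
      fix y assume "y \<in> f ` V"
      then show "\<exists>x\<in>V. norm x \<le> C * norm y \<and> y - f x \<in> f ` V \<and> norm (y - f x) \<le> norm y / 2"
        using C(2)[of y] subspace_diff[OF Ws] by blast
    qed
  qed
qed

text \<open>
  The converse of the open mapping theorem, by which closedness of an image becomes an estimate that
  can be tested under perturbation.
\<close>

lemma closed_image_if_bounded_preimages:
  fixes f :: "'a::banach \<Rightarrow> 'b::real_normed_vector"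
  assumes f: "bounded_linear f" and V: "subspace V" "closed V" and "C \<ge> 0"
    and pre: "\<And>y. y \<in> f ` V \<Longrightarrow> \<exists>x\<in>V. f x = y \<and> norm x \<le> C * norm y"
  shows "closed (f ` V)"
proof -
  interpret f: bounded_linear f by fact
  have Ws: "subspace (f ` V)" by (rule subspace_image_bounded_linear) fact+
  have closure_diff: "y - w \<in> closure (f ` V)" if y: "y \<in> closure (f ` V)" and w: "w \<in> f ` V" for y w
  proof -
    obtain s where "\<forall>k. s k \<in> f ` V" "s \<longlonglongrightarrow> y"
      using y unfolding closure_sequential by blast
    then show ?thesis
      unfolding closure_sequential using w
      by (intro exI[of _ "\<lambda>k. s k - w"]) (auto intro!: tendsto_intros subspace_diff[OF Ws])
  qed
  have "closure (f ` V) \<subseteq> f ` V"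
  proof
    fix y assume y: "y \<in> closure (f ` V)"
    have "\<exists>x\<in>V. f x = y \<and> norm x \<le> 2 * (2 * C) * norm y"
    proof (rule exact_solution_of_approximate[OF f V _ _ y])
      show "0 \<le> 2 * C" using \<open>C \<ge> 0\<close> by simp
      fix y assume y: "y \<in> closure (f ` V)"
      show "\<exists>x\<in>V. norm x \<le> 2 * C * norm y \<and> y - f x \<in> closure (f ` V) \<and>
          norm (y - f x) \<le> norm y / 2"
      proof (cases "y = 0")
        case True
        then show ?thesis using subspace_0[OF V(1)] y
          by (intro bexI[of _ 0]) (auto simp: f.zero)
      next
        case False
        then obtain w where w: "w \<in> f ` V" "norm (w - y) < norm y / 2"
          using y unfolding closure_approachable dist_norm by (metis half_gt_zero zero_less_norm_iff)
        then obtain x where x: "x \<in> V" "f x = w" "norm x \<le> C * norm w" using pre by blast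
        have "norm w \<le> 2 * norm y" using w(2) norm_triangle_ineq2[of w y] norm_ge_zero[of y] by linarith
        hence "norm x \<le> 2 * C * norm y"
          using x(3) mult_left_mono[of "norm w" "2 * norm y" C] \<open>C \<ge> 0\<close> by simp
        moreover have "y - f x \<in> closure (f ` V)"
          using closure_diff[OF y w(1)] x by simp
        ultimately show ?thesis using x w by (intro bexI[of _ x]) (auto simp: norm_minus_commute)
      qed
    qed
    thus "y \<in> f ` V" by blast
  qed
  thus ?thesis by (simp add: closure_subset_eq)
qed

text \<open>
  The form in which the open mapping theorem enters the closed range arguments: convergent images
  lift to convergent preimages, at the price of changing the preimages by elements of the kernel.
\<close>

lemma convergent_preimages_of_convergent:
  fixes f :: "'a::banach \<Rightarrow> 'b::banach"
  assumes f: "bounded_linear f" and V: "subspace V" "closed V" and W: "closed (f ` V)"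
    and x: "\<And>k. x k \<in> V" and lim: "(\<lambda>k. f (x k)) \<longlonglongrightarrow> y"
  obtains u v where "\<And>k. u k \<in> V" "\<And>k. f (u k) = f (x k)" "u \<longlonglongrightarrow> v" "v \<in> V" "f v = y"
proof -
  interpret f: bounded_linear f by fact
  obtain C where C: "C \<ge> 0" "\<And>y. y \<in> f ` V \<Longrightarrow> \<exists>x\<in>V. f x = y \<and> norm x \<le> C * norm y"
    using open_mapping_closed_subspace[OF f V W] by blast
  have "y \<in> f ` V" using closed_sequentially[OF W _ lim] x by blast
  then obtain v where v: "v \<in> V" "f v = y" by blast
  have "\<exists>e\<in>V. f e = f (x k) - y \<and> norm e \<le> C * norm (f (x k) - y)" for k
  proof (rule C(2))
    have "f (x k) - y = f (x k - v)" using v by (simp add: f.diff)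
    thus "f (x k) - y \<in> f ` V" using subspace_diff[OF V(1) x v(1)] by blast
  qed
  then obtain e where e: "\<And>k. e k \<in> V" "\<And>k. f (e k) = f (x k) - y"
      "\<And>k. norm (e k) \<le> C * norm (f (x k) - y)"
    by metis
  have "(\<lambda>k. C * norm (f (x k) - y)) \<longlonglongrightarrow> C * norm (y - y)"
    by (intro tendsto_intros lim)
  hence "(\<lambda>k. C * norm (f (x k) - y)) \<longlonglongrightarrow> 0" by simp
  hence "e \<longlonglongrightarrow> 0" by (rule Lim_null_comparison[rotated]) (simp add: e)
  hence "(\<lambda>k. v + e k) \<longlonglongrightarrow> v" using tendsto_add[of "\<lambda>_. v" v _ e 0] by simp
  thus thesis using v e subspace_add[OF V(1)] by (intro that[of "\<lambda>k. v + e k" v]) (auto simp: f.add)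
qed

section \<open>Finite-dimensional subspaces\<close>

lemma real_subspace_of_complex:
  "complex_vector.subspace V \<Longrightarrow> subspace V"
  unfolding subspace_def complex_vector.subspace_def by (metis scaleC_of_real)

lemma bounded_linear_scaleC_left: "bounded_linear (\<lambda>c. c *\<^sub>C x)"
proof
  show "(r *\<^sub>R c) *\<^sub>C x = r *\<^sub>R c *\<^sub>C x" for r :: real and c
    by (simp only: scaleR_conv_of_real scaleC_scaleC[symmetric] scaleC_of_real)
  show "\<exists>K. \<forall>c. norm (c *\<^sub>C x) \<le> norm c * K" by (auto simp: norm_scaleC)
qed (rule scaleC_add_left)

lemma bounded_linear_scaleC_right: "bounded_linear (\<lambda>x. c *\<^sub>C x)"
proof
  show "c *\<^sub>C r *\<^sub>R x = r *\<^sub>R c *\<^sub>C x" for r and x :: 'a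
    by (simp only: scaleC_of_real[symmetric] scaleC_scaleC mult.commute)
  show "\<exists>K. \<forall>x::'a. norm (c *\<^sub>C x) \<le> norm x * K"
    by (rule exI[of _ "cmod c"]) (simp add: norm_scaleC)
qed (rule scaleC_add_right)

text \<open>
  The distance from \<open>b\<close> to the closed span is positive and serves as \<open>\<delta>\<close>.
\<close>

lemma coefficient_bound_outside_closed_span:
  assumes cl: "closed (complex_vector.span S)" and b: "b \<notin> complex_vector.span S"
  obtains \<delta> where "\<delta> > 0" "\<And>c v. v \<in> complex_vector.span S \<Longrightarrow> \<delta> * cmod c \<le> norm (c *\<^sub>C b + v)"
proof (rule that)
  let ?L = "complex_vector.span S"
  have ne: "?L \<noteq> {}" using complex_vector.span_zero by blast
  show "infdist b ?L > 0"
    using in_closed_iff_infdist_zero[OF cl ne, of b] b infdist_nonneg[of b ?L] by simp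
  fix c v assume v: "v \<in> ?L"
  show "infdist b ?L * cmod c \<le> norm (c *\<^sub>C b + v)"
  proof (cases "c = 0")
    case False
    let ?w = "(- inverse c) *\<^sub>C v"
    have "?w \<in> ?L" using v by (rule complex_vector.span_scale)
    hence "infdist b ?L \<le> norm (b - ?w)" by (metis infdist_le dist_norm)
    hence "infdist b ?L * cmod c \<le> cmod c * norm (b - ?w)"
      by (simp add: mult.commute mult_left_mono)
    also have "\<dots> = norm (c *\<^sub>C (b - ?w))" by (simp add: norm_scaleC)
    also have "c *\<^sub>C (b - ?w) = c *\<^sub>C b + v"
      using False by (simp add: complex_vector.scale_right_distrib)
    finally show ?thesis .
  qed simp
qed

text \<open>
  By the coefficient bound, the coefficients of \<open>b\<close> along a convergent sequence form a Cauchy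
  sequence. This yields closedness of finite-dimensional subspaces, and of their sums with closed
  subspaces, without compactness.
\<close>

lemma closed_span_insert:
  assumes cl: "closed (complex_vector.span S)"
  shows "closed (complex_vector.span (insert b S))"
proof (cases "b \<in> complex_vector.span S")
  case True
  then show ?thesis using cl by (simp add: complex_vector.span_redundant)
next
  case False
  then obtain \<delta> where \<delta>: "\<delta> > 0"
    "\<And>c v. v \<in> complex_vector.span S \<Longrightarrow> \<delta> * cmod c \<le> norm (c *\<^sub>C b + v)"
    using coefficient_bound_outside_closed_span[OF cl] by blast
  show ?thesis unfolding closed_sequential_limits
  proof (intro allI impI, elim conjE)
    fix x l assume x: "\<forall>n. x n \<in> complex_vector.span (insert b S)" and l: "x \<longlonglongrightarrow> l"
    then obtain c where c: "\<And>n. x n - c n *\<^sub>C b \<in> complex_vector.span S"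
      by (auto simp: complex_vector.span_insert) metis
    have bound: "\<delta> * cmod (c m - c n) \<le> norm (x m - x n)" for m n
    proof -
      have "(x m - c m *\<^sub>C b) - (x n - c n *\<^sub>C b) \<in> complex_vector.span S"
        by (intro complex_vector.span_diff c)
      from \<delta>(2)[OF this, of "c m - c n"] show ?thesis
        by (simp add: complex_vector.scale_left_diff_distrib algebra_simps)
    qed
    have "Cauchy c"
    proof (rule metric_CauchyI)
      fix e :: real assume "e > 0"
      then have "\<delta> * e > 0" using \<delta>(1) by simp
      from metric_CauchyD[OF LIMSEQ_imp_Cauchy[OF l] this]
      obtain M where M: "\<And>m n. m \<ge> M \<Longrightarrow> n \<ge> M \<Longrightarrow> norm (x m - x n) < \<delta> * e"
        by (auto simp: dist_norm)
      have "dist (c m) (c n) < e" if "m \<ge> M" "n \<ge> M" for m n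
        using le_less_trans[OF bound M[OF that]] \<delta>(1) by (simp add: dist_norm)
      then show "\<exists>M. \<forall>m\<ge>M. \<forall>n\<ge>M. dist (c m) (c n) < e" by blast
    qed
    then obtain d where d: "c \<longlonglongrightarrow> d" using Cauchy_convergent convergent_def by blast
    have "(\<lambda>n. x n - c n *\<^sub>C b) \<longlonglongrightarrow> l - d *\<^sub>C b"
      by (intro tendsto_diff l bounded_linear.tendsto[OF bounded_linear_scaleC_left d])
    then have "l - d *\<^sub>C b \<in> complex_vector.span S"
      using closed_sequentially[OF cl, of "\<lambda>n. x n - c n *\<^sub>C b"] c by simp
    then show "l \<in> complex_vector.span (insert b S)" by (auto simp: complex_vector.span_insert)
  qed
qed

lemma closed_span_finite_Un:
  assumes "finite B" and cl: "closed (complex_vector.span S)"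
  shows "closed (complex_vector.span (B \<union> S))"
  using \<open>finite B\<close> by induction (simp_all add: cl closed_span_insert)

lemma cfinite_dim_closed: "cfinite_dim V \<Longrightarrow> closed V"
  using closed_span_finite_Un[of _ "{}"] by (auto simp: cfinite_dim_def)

text \<open>
  Equivalence of norms on a finite-dimensional space. Each coefficient is bounded separately, since
  \<open>b\<close> lies outside the closed span of the other basis vectors.
\<close>

lemma sum_coefficients_bound:
  assumes B: "finite B" and ind: "complex_vector.independent B"
  obtains C where "C \<ge> 0" "\<And>c. (\<Sum>b\<in>B. cmod (c b)) \<le> C * norm (\<Sum>b\<in>B. c b *\<^sub>C b)"
proof -
  have "\<exists>C\<ge>0. \<forall>c. cmod (c b) \<le> C * norm (\<Sum>b\<in>B. c b *\<^sub>C b)" if b: "b \<in> B" for b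
  proof -
    have "b \<notin> complex_vector.span (B - {b})" using ind b by (auto simp: complex_vector.dependent_def)
    moreover have "closed (complex_vector.span (B - {b}))"
      using closed_span_finite_Un[of "B - {b}" "{}"] B by simp
    ultimately obtain \<delta> where \<delta>: "\<delta> > 0"
      "\<And>c v. v \<in> complex_vector.span (B - {b}) \<Longrightarrow> \<delta> * cmod c \<le> norm (c *\<^sub>C b + v)"
      using coefficient_bound_outside_closed_span by blast
    have "cmod (c b) \<le> (1 / \<delta>) * norm (\<Sum>b\<in>B. c b *\<^sub>C b)" for c
    proof -
      have "(\<Sum>b\<in>B - {b}. c b *\<^sub>C b) \<in> complex_vector.span (B - {b})"
        by (intro complex_vector.span_sum complex_vector.span_scale complex_vector.span_base) auto
      from \<delta>(2)[OF this, of "c b"] show ?thesis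
        using \<delta>(1) b B by (simp add: sum.remove field_simps)
    qed
    then show ?thesis using \<delta>(1) by (intro exI[of _ "1 / \<delta>"]) auto
  qed
  then obtain C where C: "\<And>b. b \<in> B \<Longrightarrow> C b \<ge> 0"
    "\<And>b c. b \<in> B \<Longrightarrow> cmod (c b) \<le> C b * norm (\<Sum>b\<in>B. c b *\<^sub>C b)"
    by metis
  show thesis
  proof (rule that[of "sum C B"])
    show "sum C B \<ge> 0" using C(1) by (rule sum_nonneg)
    fix c :: "'a \<Rightarrow> complex"
    show "(\<Sum>b\<in>B. cmod (c b)) \<le> sum C B * norm (\<Sum>b\<in>B. c b *\<^sub>C b)"
      unfolding sum_distrib_right by (rule sum_mono) (rule C(2))
  qed
qed

lemma cfinite_dim_basis_of_subspace:
  assumes V: "complex_vector.subspace V" "V \<subseteq> W" and W: "cfinite_dim W"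
  obtains B where "finite B" "complex_vector.independent B" "V = complex_vector.span B"
proof -
  obtain A where A: "finite A" "W = complex_vector.span A" using W by (auto simp: cfinite_dim_def)
  obtain B where B: "B \<subseteq> V" "complex_vector.independent B" "V \<subseteq> complex_vector.span B"
    using complex_vector.maximal_independent_subset[of V] by blast
  have "finite B" using complex_vector.independent_span_bound[OF A(1) B(2)] B(1) V(2) A(2) by blast
  moreover have "complex_vector.span B \<subseteq> V" by (rule complex_vector.span_minimal[OF B(1) V(1)])
  ultimately show thesis using B that by blast
qed

lemma cfinite_dim_subspace:
  "complex_vector.subspace V \<Longrightarrow> V \<subseteq> W \<Longrightarrow> cfinite_dim W \<Longrightarrow> cfinite_dim V"
  by (metis cfinite_dim_basis_of_subspace cfinite_dim_def)

text \<open>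
  The sequence is constant from a term of least dimension on.
\<close>

lemma decreasing_cfinite_dim_stabilizes:
  assumes sub: "\<And>k. complex_vector.subspace (F k)" and dec: "\<And>k. F (Suc k) \<subseteq> F k"
    and fin: "cfinite_dim (F 0)"
  obtains d where "\<And>m. d \<le> m \<Longrightarrow> F m = F d"
proof -
  have anti: "F m \<subseteq> F k" if "k \<le> m" for k m
    using that by (induction rule: dec_induct) (use dec in auto)
  have "\<exists>B. finite B \<and> complex_vector.independent B \<and> F k = complex_vector.span B" for k
    using cfinite_dim_basis_of_subspace[OF sub anti fin] by (metis zero_le)
  then obtain B where B: "\<And>k. finite (B k)" "\<And>k. complex_vector.independent (B k)"
    "\<And>k. F k = complex_vector.span (B k)" by metis
  define d where "d = (ARG_MIN (\<lambda>k. card (B k)) k. True)"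
  have d: "card (B d) \<le> card (B k)" for k unfolding d_def by (rule arg_min_nat_le) simp
  have "F m = F d" if "d \<le> m" for m
  proof (rule antisym)
    show "F m \<subseteq> F d" by (rule anti[OF that])
    show "F d \<subseteq> F m"
    proof
      fix x assume x: "x \<in> F d"
      show "x \<in> F m"
      proof (rule ccontr)
        assume "x \<notin> F m"
        hence nx: "x \<notin> complex_vector.span (B m)" using B by simp
        hence "complex_vector.independent (insert x (B m))"
          using B(2) by (simp add: complex_vector.independent_insert)
        moreover have "insert x (B m) \<subseteq> complex_vector.span (B d)"
          using x anti[OF that] B(3) complex_vector.span_superset[of "B m"] by auto
        ultimately have "card (insert x (B m)) \<le> card (B d)"
          using complex_vector.independent_span_bound[OF B(1)[of d]] by blast
        moreover have "x \<notin> B m" using nx complex_vector.span_base by blast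
        ultimately show False using d[of m] B(1)[of m] by simp
      qed
    qed
  qed
  thus thesis by (rule that)
qed

section \<open>Bounded operators and closed ranges\<close>

lemma bounded_clinearD:
  assumes "bounded_clinear S"
  shows "bounded_linear S" "S (c *\<^sub>C x) = c *\<^sub>C S x"
    "S (x + y) = S x + S y" "S (x - y) = S x - S y" "S 0 = 0"
  using assms unfolding bounded_clinear_def
  by (auto simp: bounded_linear.linear linear_add linear_diff linear_0)

lemma bounded_clinear_funpow: "bounded_clinear S \<Longrightarrow> bounded_clinear (S ^^ n)"
  by (induction n) (auto simp: bounded_clinear_def o_def bounded_linear_compose bounded_linear_ident id_def)

lemma bounded_clinear_shift: "bounded_clinear S \<Longrightarrow> bounded_clinear (shift S \<mu>)"
  unfolding bounded_clinear_def shift_def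
  by (auto intro!: bounded_linear_sub bounded_linear_compose[OF bounded_linear_scaleC_right]
      bounded_linear_ident simp: complex_vector.scale_right_diff_distrib mult.commute)

lemma subspace_image_clinear:
  assumes "bounded_clinear S" "complex_vector.subspace V"
  shows "complex_vector.subspace (S ` V)"
proof (rule complex_vector.subspaceI)
  show "0 \<in> S ` V"
    using bounded_clinearD(5)[OF assms(1)] complex_vector.subspace_0[OF assms(2)] by (metis imageI)
next
  fix x y assume "x \<in> S ` V" "y \<in> S ` V"
  then obtain u v where "u \<in> V" "v \<in> V" "x = S u" "y = S v" by blast
  then show "x + y \<in> S ` V"
    using complex_vector.subspace_add[OF assms(2), of u v] bounded_clinearD(3)[OF assms(1), of u v]
    by (metis imageI)
next
  fix c x assume "x \<in> S ` V"
  then obtain u where "u \<in> V" "x = S u" by blast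
  then show "c *\<^sub>C x \<in> S ` V"
    using complex_vector.subspace_scale[OF assms(2), of u c] bounded_clinearD(2)[OF assms(1), of c u]
    by (metis imageI)
qed

lemma subspace_range_clinear: "bounded_clinear S \<Longrightarrow> complex_vector.subspace (range S)"
  by (rule subspace_image_clinear[OF _ complex_vector.subspace_UNIV])

lemma subspace_kernel_in:
  assumes "bounded_clinear S" "complex_vector.subspace V"
  shows "complex_vector.subspace {x \<in> V. S x = 0}"
  using assms(2) unfolding complex_vector.subspace_def
  by (simp add: bounded_clinearD[OF assms(1)])

text \<open>
  An upper semi-Fredholm operator maps closed subspaces to closed subspaces. Given
  \<open>f (x k) \<longlonglongrightarrow> l\<close> with \<open>x k \<in> W\<close>, a lift converges to some \<open>v\<close> and differs from \<open>x k\<close> by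
  kernel elements, so \<open>v\<close> lies in the sum of \<open>W\<close> and the kernel. This sum is closed because the
  kernel is finite-dimensional, and the kernel part of \<open>v\<close> does not contribute to \<open>f v = l\<close>.
\<close>

lemma closed_image_of_closed_subspace:
  assumes f: "bounded_clinear f" and V: "complex_vector.subspace V" "closed V" "closed (f ` V)"
    and fin: "cfinite_dim {x \<in> V. f x = 0}"
    and W: "complex_vector.subspace W" "closed W" "W \<subseteq> V"
  shows "closed (f ` W)"
  unfolding closed_sequential_limits
proof (intro allI impI, elim conjE)
  fix y l assume y: "\<forall>n. y n \<in> f ` W" and l: "y \<longlonglongrightarrow> l"
  from y have "\<forall>n. \<exists>x. x \<in> W \<and> f x = y n" by (simp add: image_iff) metis
  then obtain x where x: "\<And>n. x n \<in> W" "\<And>n. f (x n) = y n" by metis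
  obtain u v where uv: "\<And>k. u k \<in> V" "\<And>k. f (u k) = f (x k)" "u \<longlonglongrightarrow> v" "v \<in> V" "f v = l"
  proof (rule convergent_preimages_of_convergent)
    show "bounded_linear f" by (rule bounded_clinearD(1)[OF f])
    show "subspace V" by (rule real_subspace_of_complex[OF V(1)])
    show "x k \<in> V" for k using x W by blast
    show "(\<lambda>k. f (x k)) \<longlonglongrightarrow> l" using l by (simp add: x)
  qed (use V in auto)
  obtain B where B: "finite B" "{x \<in> V. f x = 0} = complex_vector.span B"
    using fin by (auto simp: cfinite_dim_def)
  have spanW: "complex_vector.span W = W" using W(1) by (rule complex_vector.span_eq_iff[THEN iffD2])
  have cl: "closed (complex_vector.span (B \<union> W))"
    by (rule closed_span_finite_Un[OF B(1)]) (simp add: spanW W)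
  have "u k \<in> complex_vector.span (B \<union> W)" for k
  proof -
    have "u k - x k \<in> {x \<in> V. f x = 0}"
      using uv(2)[of k] complex_vector.subspace_diff[OF V(1) uv(1)[of k] subsetD[OF W(3) x(1)[of k]]]
      by (simp add: bounded_clinearD[OF f])
    moreover have "u k = (u k - x k) + x k" by simp
    ultimately show ?thesis
      unfolding complex_vector.span_Un spanW B(2) using x(1) by blast
  qed
  with closed_sequentially[OF cl _ uv(3)] have "v \<in> complex_vector.span (B \<union> W)" by blast
  then obtain g w where "v = g + w" "g \<in> complex_vector.span B" "w \<in> W"
    unfolding complex_vector.span_Un spanW by blast
  then have "f w = l" using B(2) uv(5) by (auto simp: bounded_clinearD[OF f])
  then show "l \<in> f ` W" using \<open>w \<in> W\<close> by blast
qed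

text \<open>
  A closed range of \<open>g \<circ> f\<close> passes to \<open>f\<close>: if \<open>f (x k) \<longlonglongrightarrow> l\<close>, lift \<open>g (f (x k))\<close> to a
  convergent sequence \<open>u k\<close>; the error \<open>f (x k) - f (u k)\<close> stays in the closed set of those points
  of the range of \<open>f\<close> that \<open>g\<close> kills.
\<close>

lemma closed_range_of_composition:
  fixes f :: "'a::banach \<Rightarrow> 'b::banach" and g :: "'b \<Rightarrow> 'c::banach"
  assumes f: "bounded_linear f" and g: "bounded_linear g" and cl: "closed (range (\<lambda>x. g (f x)))"
    and ker: "closed {y \<in> range f. g y = 0}"
  shows "closed (range f)"
  unfolding closed_sequential_limits
proof (intro allI impI, elim conjE)
  interpret f: bounded_linear f by fact
  interpret g: bounded_linear g by fact
  fix y l assume y: "\<forall>n. y n \<in> range f" and l: "y \<longlonglongrightarrow> l"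
  from y have "\<forall>n. \<exists>x. f x = y n" by (simp add: image_iff) metis
  then obtain x where x: "\<And>n. f (x n) = y n" by metis
  obtain u v where uv: "\<And>k. g (f (u k)) = g (f (x k))" "u \<longlonglongrightarrow> v"
  proof (rule convergent_preimages_of_convergent)
    show "bounded_linear (\<lambda>x. g (f x))" by (rule bounded_linear_compose[OF g f])
    show "(\<lambda>k. g (f (x k))) \<longlonglongrightarrow> g l" unfolding x by (rule g.tendsto[OF l])
  qed (use cl in auto)
  have lim: "(\<lambda>k. y k - f (u k)) \<longlonglongrightarrow> l - f v" by (intro tendsto_diff l f.tendsto uv)
  have mem: "y k - f (u k) \<in> {y \<in> range f. g y = 0}" for k
  proof -
    have "y k - f (u k) = f (x k - u k)" by (simp add: f.diff x)
    moreover have "g (y k - f (u k)) = 0" using uv(1)[of k] by (simp add: g.diff x)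
    ultimately show ?thesis by simp
  qed
  have "l - f v \<in> {y \<in> range f. g y = 0}" by (rule closed_sequentially[OF ker mem lim])
  then have "l - f v \<in> range f" by simp
  then obtain w where "l - f v = f w" by blast
  then have "l = f (v + w)" by (simp add: f.add algebra_simps)
  then show "l \<in> range f" by blast
qed

section \<open>Ranges of powers and the hyperrange\<close>

lemma image_range_funpow:
  fixes S :: "'a \<Rightarrow> 'a"
  shows "S ` range (S ^^ m) = range (S ^^ Suc m)"
  by (simp add: image_comp)

lemma range_funpow_antimono:
  fixes S :: "'a \<Rightarrow> 'a"
  assumes "n \<le> m"
  shows "range (S ^^ m) \<subseteq> range (S ^^ n)"
proof -
  have "S ^^ m = S ^^ n \<circ> S ^^ (m - n)" using assms by (simp flip: funpow_add)
  then show ?thesis by auto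
qed

definition kernel_in_range_power :: "('a::complex_banach \<Rightarrow> 'a) \<Rightarrow> nat \<Rightarrow> 'a set"
  where "kernel_in_range_power S m = {x \<in> range (S ^^ m). S x = 0}"

definition hyperrange :: "('a \<Rightarrow> 'a) \<Rightarrow> 'a set"
  where "hyperrange S = (\<Inter>m. range (S ^^ m))"

lemma subspace_kernel_in_range_power:
  "bounded_clinear S \<Longrightarrow> complex_vector.subspace (kernel_in_range_power S m)"
  unfolding kernel_in_range_power_def
  by (intro subspace_kernel_in subspace_range_clinear bounded_clinear_funpow)

lemma kernel_in_range_power_antimono:
  "n \<le> m \<Longrightarrow> kernel_in_range_power S m \<subseteq> kernel_in_range_power S n"
  using range_funpow_antimono[of n m S] by (auto simp: kernel_in_range_power_def)

text \<open>
  The closed set needed to split \<open>S ^^ Suc m\<close> as \<open>S \<circ> S ^^ m\<close> is the trace of the kernel, which is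
  finite-dimensional. The lemma serves to descend from a power with closed range in two situations:
  for operators of finite nullity, and above the ascent, where the kernel meets the range of the
  power in \<open>0\<close> only.
\<close>

lemma closed_range_funpow_descend:
  assumes S: "bounded_clinear S" and cl: "closed (range (S ^^ Suc m))"
    and fin: "cfinite_dim (kernel_in_range_power S m)"
  shows "closed (range (S ^^ m))"
proof (rule closed_range_of_composition)
  show "bounded_linear (S ^^ m)" "bounded_linear S"
    using S bounded_clinear_funpow bounded_clinearD(1) by blast+
  show "closed (range (\<lambda>x. S ((S ^^ m) x)))" using cl by (simp add: o_def)
  show "closed {y \<in> range (S ^^ m). S y = 0}"
    using cfinite_dim_closed[OF fin] by (simp add: kernel_in_range_power_def)
qed

text \<open>
  From the index \<open>n\<close> of the definition on, all ranges are closed because the restriction to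
  \<open>range (S ^^ n)\<close> maps closed subspaces to closed subspaces. The traces of the kernel on these
  ranges decrease and are finite-dimensional, so they become constant.
\<close>

lemma upper_semi_b_fredholm_stable_powers:
  assumes S: "bounded_clinear S" and b: "upper_semi_b_fredholm S"
  obtains d where "\<And>m. d \<le> m \<Longrightarrow> closed (range (S ^^ m))"
    "\<And>m. d \<le> m \<Longrightarrow> kernel_in_range_power S m = kernel_in_range_power S d"
    "cfinite_dim (kernel_in_range_power S d)"
proof -
  obtain n where n: "closed (range (S ^^ n))" "closedin (top_of_set (range (S ^^ n))) (S ` range (S ^^ n))"
    "cfinite_dim (kernel_in_range_power S n)"
    using b unfolding upper_semi_b_fredholm_def upper_semi_fredholm_on_def kernel_in_range_power_def
    by blast
  have cln: "closed (S ` range (S ^^ n))" by (rule closedin_closed_trans[OF n(2,1)])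
  have closed: "closed (range (S ^^ m))" if "n \<le> m" for m
    using that
  proof (induction rule: dec_induct)
    case (step m)
    have "closed (S ` range (S ^^ m))"
      by (rule closed_image_of_closed_subspace[OF S _ n(1) cln n(3)[unfolded kernel_in_range_power_def]])
        (use step range_funpow_antimono[of n m S] in
          \<open>auto intro!: subspace_range_clinear bounded_clinear_funpow S\<close>)
    then show ?case by (simp only: image_range_funpow)
  qed (rule n(1))
  obtain d where d: "\<And>m. d \<le> m \<Longrightarrow> kernel_in_range_power S (n + m) = kernel_in_range_power S (n + d)"
  proof (rule decreasing_cfinite_dim_stabilizes[of "\<lambda>k. kernel_in_range_power S (n + k)"])
    show "cfinite_dim (kernel_in_range_power S (n + 0))" using n(3) by simp
    show "complex_vector.subspace (kernel_in_range_power S (n + k))" for k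
      by (rule subspace_kernel_in_range_power[OF S])
    show "kernel_in_range_power S (n + Suc k) \<subseteq> kernel_in_range_power S (n + k)" for k
      by (rule kernel_in_range_power_antimono) simp
  qed blast
  show thesis
  proof (rule that[of "n + d"])
    fix m assume m: "n + d \<le> m"
    show "closed (range (S ^^ m))" using closed m by simp
    have "m = n + (m - n)" "d \<le> m - n" using m by auto
    then show "kernel_in_range_power S m = kernel_in_range_power S (n + d)" using d by metis
  next
    show "cfinite_dim (kernel_in_range_power S (n + d))"
      by (rule cfinite_dim_subspace[OF subspace_kernel_in_range_power[OF S]
            kernel_in_range_power_antimono n(3)]) simp
  qed
qed

lemma subspace_hyperrange:
  "bounded_clinear S \<Longrightarrow> complex_vector.subspace (hyperrange S)"
  unfolding hyperrange_def
  by (rule complex_vector.subspace_Inter) (auto intro!: subspace_range_clinear bounded_clinear_funpow)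

lemma closed_hyperrange:
  assumes "\<And>m. d \<le> m \<Longrightarrow> closed (range (S ^^ m))"
  shows "closed (hyperrange S)"
proof -
  have "range (S ^^ (d + m)) \<subseteq> range (S ^^ m)" for m
    by (rule range_funpow_antimono) simp
  then have "hyperrange S = (\<Inter>m. range (S ^^ (d + m)))"
    unfolding hyperrange_def by (intro antisym INT_greatest) (blast intro: INT_lower)+
  also have "closed \<dots>" by (intro closed_INT ballI assms) simp
  finally show ?thesis .
qed

lemma kernel_subset_hyperrange:
  assumes "\<And>m. d \<le> m \<Longrightarrow> kernel_in_range_power S m = kernel_in_range_power S d"
  shows "kernel_in_range_power S d \<subseteq> hyperrange S"
proof
  fix x assume x: "x \<in> kernel_in_range_power S d"
  have "x \<in> range (S ^^ m)" for m
  proof -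
    have "x \<in> kernel_in_range_power S (d + m)" using x assms[of "d + m"] by simp
    then have "x \<in> range (S ^^ (d + m))" by (simp add: kernel_in_range_power_def)
    then show ?thesis using range_funpow_antimono[of m "d + m" S] by auto
  qed
  then show "x \<in> hyperrange S" by (simp add: hyperrange_def)
qed

text \<open>
  A preimage of \<open>y\<close> in \<open>range (S ^^ d)\<close> differs from a preimage in \<open>range (S ^^ m)\<close> by an
  element of the stable trace of the kernel, which is contained in the hyperrange. Hence the former
  preimage already lies in every range.
\<close>

lemma image_hyperrange:
  assumes S: "bounded_clinear S"
    and stab: "\<And>m. d \<le> m \<Longrightarrow> kernel_in_range_power S m = kernel_in_range_power S d"
  shows "S ` hyperrange S = hyperrange S"
proof
  show "S ` hyperrange S \<subseteq> hyperrange S"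
  proof
    fix y assume "y \<in> S ` hyperrange S"
    then obtain x where x: "x \<in> hyperrange S" "y = S x" by blast
    have "y \<in> range (S ^^ m)" for m
    proof -
      have "y \<in> S ` range (S ^^ m)" using x by (auto simp: hyperrange_def)
      then have "y \<in> range (S ^^ Suc m)" by (simp only: image_range_funpow)
      then show ?thesis using range_funpow_antimono[of m "Suc m" S] by auto
    qed
    then show "y \<in> hyperrange S" by (simp add: hyperrange_def)
  qed
  show "hyperrange S \<subseteq> S ` hyperrange S"
  proof
    fix y assume y: "y \<in> hyperrange S"
    have "\<exists>u\<in>range (S ^^ m). S u = y" for m
    proof -
      have "y \<in> range (S ^^ Suc m)" using y unfolding hyperrange_def by blast
      then have "y \<in> S ` range (S ^^ m)" by (simp only: image_range_funpow)
      then show ?thesis by blast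
    qed
    then obtain u where u: "\<And>m. u m \<in> range (S ^^ m)" "\<And>m. S (u m) = y" by metis
    have "u d \<in> range (S ^^ m)" for m
    proof (cases "d \<le> m")
      case True
      have "u d - u m \<in> range (S ^^ d)"
        using u(1)[of d] u(1)[of m] range_funpow_antimono[OF True, of S]
        by (intro complex_vector.subspace_diff subspace_range_clinear bounded_clinear_funpow S) auto
      then have "u d - u m \<in> kernel_in_range_power S d"
        by (simp add: kernel_in_range_power_def bounded_clinearD[OF S] u)
      then have "u d - u m \<in> hyperrange S" using kernel_subset_hyperrange[OF stab] by blast
      then have "u d - u m \<in> range (S ^^ m)" by (simp add: hyperrange_def)
      from complex_vector.subspace_add[OF subspace_range_clinear[OF bounded_clinear_funpow[OF S]] this u(1)]
      show ?thesis by simp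
    next
      case False
      then show ?thesis using u(1)[of d] range_funpow_antimono[of m d S] by auto
    qed
    then have "u d \<in> hyperrange S" by (simp add: hyperrange_def)
    then show "y \<in> S ` hyperrange S" using u(2) by (metis imageI)
  qed
qed

section \<open>Small shifts on an invariant subspace\<close>

text \<open>
  A preimage of \<open>y\<close> under \<open>S\<close> solves the shifted equation up to the error \<open>\<mu> *\<^sub>C x\<close>, which is at
  most half of \<open>y\<close> when \<open>\<mu>\<close> is small. The statement at \<open>\<mu> = 0\<close> is the surjectivity of \<open>S\<close>
  with the same constant.
\<close>

lemma shift_surjective_near_zero:
  assumes S: "bounded_clinear S" and Y: "complex_vector.subspace Y" "closed Y" "S ` Y = Y"
  obtains C where "C > 0"
    "\<And>\<mu> y. C * cmod \<mu> \<le> 1 \<Longrightarrow> y \<in> Y \<Longrightarrow> \<exists>x\<in>Y. shift S \<mu> x = y \<and> norm x \<le> C * norm y"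
proof -
  have rY: "subspace Y" by (rule real_subspace_of_complex[OF Y(1)])
  obtain C0 where C0: "C0 \<ge> 0" "\<And>y. y \<in> S ` Y \<Longrightarrow> \<exists>x\<in>Y. S x = y \<and> norm x \<le> C0 * norm y"
    using open_mapping_closed_subspace[OF bounded_clinearD(1)[OF S] rY Y(2)] Y by metis
  define C where "C = C0 + 1"
  have C: "C > 0" using C0(1) by (simp add: C_def)
  have CS: "\<exists>x\<in>Y. S x = y \<and> norm x \<le> C * norm y" if y: "y \<in> Y" for y
  proof -
    obtain x where "x \<in> Y" "S x = y" "norm x \<le> C0 * norm y"
      using C0(2)[of y] y unfolding Y(3) by blast
    then show ?thesis using mult_right_mono[of C0 C "norm y"] by (intro bexI[of _ x]) (auto simp: C_def)
  qed
  show thesis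
  proof (rule that[of "2 * C"])
    show "2 * C > 0" using C by simp
    fix \<mu> y assume \<mu>: "2 * C * cmod \<mu> \<le> 1" and y: "y \<in> Y"
    show "\<exists>x\<in>Y. shift S \<mu> x = y \<and> norm x \<le> 2 * C * norm y"
    proof (rule exact_solution_of_approximate[OF bounded_clinearD(1)[OF bounded_clinear_shift[OF S]]
          rY Y(2) _ _ y])
      show "0 \<le> C" using C by simp
      fix y assume "y \<in> Y"
      then obtain x where x: "x \<in> Y" "S x = y" "norm x \<le> C * norm y" using CS by blast
      have eq: "y - shift S \<mu> x = \<mu> *\<^sub>C x" by (simp add: shift_def x)
      have "norm (\<mu> *\<^sub>C x) \<le> cmod \<mu> * (C * norm y)"
        using x(3) by (simp add: norm_scaleC mult_left_mono)
      also have "\<dots> = (2 * C * cmod \<mu>) * norm y / 2" by simp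
      also have "\<dots> \<le> norm y / 2" using mult_right_mono[OF \<mu>, of "norm y"] by simp
      finally show "\<exists>x\<in>Y. norm x \<le> C * norm y \<and> y - shift S \<mu> x \<in> Y \<and>
          norm (y - shift S \<mu> x) \<le> norm y / 2"
        using x eq complex_vector.subspace_scale[OF Y(1) x(1)] by (intro bexI[of _ x]) auto
    qed
  qed
qed

text \<open>
  If \<open>h\<close> solves \<open>shift S \<mu> h = k\<close>, then \<open>k + \<mu> *\<^sub>C h\<close> is the required eigenvector.
\<close>

lemma eigenvector_near_kernel_vector:
  assumes S: "bounded_clinear S" and Y: "complex_vector.subspace Y"
    and sol: "\<And>y. y \<in> Y \<Longrightarrow> \<exists>x\<in>Y. shift S \<mu> x = y \<and> norm x \<le> C * norm y"
    and k: "k \<in> Y" "S k = 0"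
  shows "\<exists>e\<in>Y. shift S \<mu> e = 0 \<and> norm (e - k) \<le> C * cmod \<mu> * norm k"
proof -
  obtain h where h: "h \<in> Y" "shift S \<mu> h = k" "norm h \<le> C * norm k" using sol[OF k(1)] by blast
  have "shift S \<mu> (k + \<mu> *\<^sub>C h) = shift S \<mu> k + \<mu> *\<^sub>C shift S \<mu> h"
    by (simp only: bounded_clinearD[OF bounded_clinear_shift[OF S]])
  also have "\<dots> = 0" by (simp add: h(2)) (simp add: shift_def k)
  finally have "shift S \<mu> (k + \<mu> *\<^sub>C h) = 0" .
  moreover have "norm (\<mu> *\<^sub>C h) \<le> C * cmod \<mu> * norm k"
    using mult_left_mono[OF h(3), of "cmod \<mu>"] by (simp add: norm_scaleC mult_ac)
  moreover have "k + \<mu> *\<^sub>C h \<in> Y"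
    by (intro complex_vector.subspace_add complex_vector.subspace_scale Y k h)
  ultimately show ?thesis by (intro bexI[of _ "k + \<mu> *\<^sub>C h"]) auto
qed

lemma le_infdistI:
  "A \<noteq> {} \<Longrightarrow> (\<And>a. a \<in> A \<Longrightarrow> r \<le> dist x a) \<Longrightarrow> r \<le> infdist x A"
  unfolding infdist_def by (simp add: cINF_greatest)

text \<open>
  Riesz's lemma read backwards: applied to \<open>x - a\<close> for \<open>a \<in> G\<close>, the hypothesis shows that the
  distance from \<open>x\<close> to \<open>G\<close> is at most half of itself.
\<close>

lemma closed_subspace_eq_if_halving:
  fixes G :: "'a::real_normed_vector set"
  assumes G: "subspace G" "closed G" and L: "subspace L" "G \<subseteq> L"
    and half: "\<And>x. x \<in> L \<Longrightarrow> \<exists>g\<in>G. norm (x - g) \<le> norm x / 2"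
  shows "L = G"
proof
  have ne: "G \<noteq> {}" using subspace_0[OF G(1)] by blast
  show "L \<subseteq> G"
  proof
    fix x assume x: "x \<in> L"
    have "2 * infdist x G \<le> infdist x G"
    proof (rule le_infdistI[OF ne])
      fix a assume a: "a \<in> G"
      then obtain g where g: "g \<in> G" "norm (x - a - g) \<le> norm (x - a) / 2"
        using half[of "x - a"] subspace_diff[OF L(1) x, of a] L(2) by blast
      have "infdist x G \<le> dist x (a + g)" by (intro infdist_le subspace_add G a g)
      also have "\<dots> \<le> dist x a / 2" using g(2) by (simp add: dist_norm diff_diff_eq)
      finally show "2 * infdist x G \<le> dist x a" by simp
    qed
    then have "infdist x G = 0" using infdist_nonneg[of x G] by simp
    then show "x \<in> G" using in_closed_iff_infdist_zero[OF G(2) ne] by blast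
  qed
qed (rule L(2))

text \<open>
  Each vector of a basis of the kernel of \<open>S\<close> has an eigenvector \<open>e b\<close> close to it, and these
  eigenvectors span the whole eigenspace. Indeed an eigenvector \<open>x\<close> is close to some \<open>x - z\<close> in
  the kernel, because \<open>S x = \<mu> *\<^sub>C x\<close> is small, and replacing the basis in the expansion of
  \<open>x - z\<close> by the eigenvectors changes little, because the coefficients are controlled by the norm.
  This takes the place of a bounded projection onto the kernel, which would come from the
  Hahn-Banach theorem.
\<close>

lemma cfinite_dim_shift_kernel_near_zero:
  assumes S: "bounded_clinear S" and Y: "complex_vector.subspace Y" "closed Y" "S ` Y = Y"
    and fin: "cfinite_dim {x \<in> Y. S x = 0}"
  obtains \<epsilon> where "\<epsilon> > 0" "\<And>\<mu>. cmod \<mu> < \<epsilon> \<Longrightarrow> cfinite_dim {x \<in> Y. shift S \<mu> x = 0}"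
proof -
  obtain C where C: "C > 0"
    "\<And>\<mu> y. C * cmod \<mu> \<le> 1 \<Longrightarrow> y \<in> Y \<Longrightarrow> \<exists>x\<in>Y. shift S \<mu> x = y \<and> norm x \<le> C * norm y"
    using shift_surjective_near_zero[OF S Y] by blast
  obtain B where B: "finite B" "complex_vector.independent B" "{x \<in> Y. S x = 0} = complex_vector.span B"
    using cfinite_dim_basis_of_subspace[OF subspace_kernel_in[OF S Y(1)] order_refl fin] by blast
  obtain D where D: "D \<ge> 0" "\<And>c. (\<Sum>b\<in>B. cmod (c b)) \<le> D * norm (\<Sum>b\<in>B. c b *\<^sub>C b)"
    using sum_coefficients_bound[OF B(1,2)] by blast
  define M where "M = (\<Sum>b\<in>B. norm b)"
  have M: "M \<ge> 0" "\<And>b. b \<in> B \<Longrightarrow> norm b \<le> M"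
    unfolding M_def using B(1) by (auto intro: sum_nonneg member_le_sum)
  define E where "E = C * (1 + 2 * M * D)"
  have E: "E > 0" unfolding E_def using C(1) M(1) D(1) by (intro mult_pos_pos add_pos_nonneg) auto
  have CE: "C \<le> E" unfolding E_def using C(1) M(1) D(1) by simp
  show thesis
  proof (rule that[of "1 / (2 * E)"])
    show "1 / (2 * E) > 0" using E by simp
    fix \<mu> assume "cmod \<mu> < 1 / (2 * E)"
    then have E\<mu>: "E * cmod \<mu> \<le> 1 / 2" using E by (simp add: field_simps)
    then have C\<mu>: "C * cmod \<mu> \<le> 1 / 2" using mult_right_mono[OF CE, of "cmod \<mu>"] by simp
    have sol: "\<exists>x\<in>Y. shift S \<mu> x = y \<and> norm x \<le> C * norm y" if "y \<in> Y" for y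
      using C(2)[OF _ that] C\<mu> by simp
    have sol0: "\<exists>x\<in>Y. S x = y \<and> norm x \<le> C * norm y" if "y \<in> Y" for y
      using C(2)[of 0, OF _ that] by (simp add: shift_def)
    have BY: "b \<in> Y \<and> S b = 0" if "b \<in> B" for b
      using B(3) complex_vector.span_base[OF that] by blast
    let ?L = "{x \<in> Y. shift S \<mu> x = 0}"
    have "\<exists>e\<in>?L. norm (e - b) \<le> C * cmod \<mu> * norm b" if "b \<in> B" for b
      using eigenvector_near_kernel_vector[OF S Y(1) sol, of b] BY[OF that] by auto
    then obtain e where e: "\<And>b. b \<in> B \<Longrightarrow> e b \<in> ?L"
      "\<And>b. b \<in> B \<Longrightarrow> norm (e b - b) \<le> C * cmod \<mu> * norm b" by metis
    have Ls: "complex_vector.subspace ?L"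
      by (rule subspace_kernel_in[OF bounded_clinear_shift[OF S] Y(1)])
    have "?L = complex_vector.span (e ` B)"
    proof (rule closed_subspace_eq_if_halving)
      show "subspace (complex_vector.span (e ` B))" "subspace ?L"
        by (intro real_subspace_of_complex Ls complex_vector.subspace_span)+
      show "closed (complex_vector.span (e ` B))"
        using closed_span_finite_Un[of "e ` B" "{}"] B(1) by simp
      show "complex_vector.span (e ` B) \<subseteq> ?L"
        by (intro complex_vector.span_minimal Ls image_subsetI e)
      fix x assume x: "x \<in> ?L"
      have Sx: "S x = \<mu> *\<^sub>C x" using x by (simp add: shift_def)
      obtain z where z: "z \<in> Y" "S z = \<mu> *\<^sub>C x" "norm z \<le> C * cmod \<mu> * norm x"
        using sol0[of "\<mu> *\<^sub>C x"] x complex_vector.subspace_scale[OF Y(1)]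
        by (auto simp: norm_scaleC mult_ac)
      have "x - z \<in> complex_vector.span B"
        using x z Sx complex_vector.subspace_diff[OF Y(1)]
        by (auto simp: B(3)[symmetric] bounded_clinearD[OF S])
      then obtain c where c: "x - z = (\<Sum>b\<in>B. c b *\<^sub>C b)"
        unfolding complex_vector.span_finite[OF B(1)] by blast
      define g where "g = (\<Sum>b\<in>B. c b *\<^sub>C e b)"
      have xz: "norm (x - z) \<le> 2 * norm x"
      proof -
        have "C * cmod \<mu> * norm x \<le> 1 / 2 * norm x" by (rule mult_right_mono[OF C\<mu>]) simp
        then show ?thesis using norm_triangle_ineq4[of x z] z(3) norm_ge_zero[of x] by linarith
      qed
      have "norm (x - z - g) = norm (\<Sum>b\<in>B. c b *\<^sub>C (b - e b))"
        by (simp add: c g_def sum_subtractf complex_vector.scale_right_diff_distrib)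
      also have "\<dots> \<le> (\<Sum>b\<in>B. cmod (c b) * (C * cmod \<mu> * M))"
      proof (rule sum_norm_le)
        fix b assume b: "b \<in> B"
        have "norm (b - e b) \<le> C * cmod \<mu> * norm b" using e(2)[OF b] by (simp add: norm_minus_commute)
        also have "\<dots> \<le> C * cmod \<mu> * M" using C(1) M(2)[OF b] by (intro mult_left_mono) auto
        finally show "norm (c b *\<^sub>C (b - e b)) \<le> cmod (c b) * (C * cmod \<mu> * M)"
          by (simp add: norm_scaleC mult_left_mono)
      qed
      also have "\<dots> = (\<Sum>b\<in>B. cmod (c b)) * (C * cmod \<mu> * M)" by (simp add: sum_distrib_right)
      also have "\<dots> \<le> (D * norm (x - z)) * (C * cmod \<mu> * M)"
        using D(2)[of c] C(1) M(1) by (intro mult_right_mono) (auto simp: c)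
      also have "\<dots> \<le> (D * (2 * norm x)) * (C * cmod \<mu> * M)"
        using xz D(1) C(1) M(1) by (intro mult_right_mono mult_left_mono) auto
      finally have "norm (x - z - g) \<le> (D * (2 * norm x)) * (C * cmod \<mu> * M)" .
      then have "norm (x - g) \<le> C * cmod \<mu> * norm x + (D * (2 * norm x)) * (C * cmod \<mu> * M)"
        using norm_triangle_ineq[of z "x - z - g"] z(3) by simp
      also have "\<dots> = (E * cmod \<mu>) * norm x" by (simp add: E_def algebra_simps)
      also have "\<dots> \<le> 1 / 2 * norm x" by (rule mult_right_mono[OF E\<mu>]) simp
      finally have "norm (x - g) \<le> norm x / 2" by simp
      moreover have "g \<in> complex_vector.span (e ` B)" unfolding g_def
        by (intro complex_vector.span_sum complex_vector.span_scale complex_vector.span_base) auto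
      ultimately show "\<exists>g\<in>complex_vector.span (e ` B). norm (x - g) \<le> norm x / 2" by blast
    qed
    then show "cfinite_dim ?L" unfolding cfinite_dim_def using B(1) by blast
  qed
qed

text \<open>
  Modulo \<open>Y\<close> the operator is bounded below, and on \<open>Y\<close> it is surjective; both properties survive
  a small shift and together bound the preimages. The kernel condition makes the operator injective
  modulo \<open>Y\<close>: if \<open>S x = S u\<close> with \<open>u \<in> Y\<close>, then \<open>x - u \<in> Y\<close>.
\<close>

lemma closed_shift_image_near_zero:
  assumes S: "bounded_clinear S" and Y: "complex_vector.subspace Y" "closed Y" "S ` Y = Y"
    and V: "complex_vector.subspace V" "closed V" "closed (S ` V)"
    and YV: "Y \<subseteq> V" and ker: "{x \<in> V. S x = 0} \<subseteq> Y"
  obtains \<epsilon> where "\<epsilon> > 0" "\<And>\<mu>. cmod \<mu> < \<epsilon> \<Longrightarrow> closed (shift S \<mu> ` V)"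
proof -
  have ne: "Y \<noteq> {}" using complex_vector.subspace_0[OF Y(1)] by blast
  obtain C where C: "C > 0"
    "\<And>\<mu> y. C * cmod \<mu> \<le> 1 \<Longrightarrow> y \<in> Y \<Longrightarrow> \<exists>x\<in>Y. shift S \<mu> x = y \<and> norm x \<le> C * norm y"
    using shift_surjective_near_zero[OF S Y] by blast
  obtain D where D: "D \<ge> 0" "\<And>y. y \<in> S ` V \<Longrightarrow> \<exists>x\<in>V. S x = y \<and> norm x \<le> D * norm y"
    using open_mapping_closed_subspace[OF bounded_clinearD(1)[OF S]
        real_subspace_of_complex[OF V(1)] V(2,3)] by metis
  define \<epsilon> where "\<epsilon> = 1 / (2 * (C + D))"
  show thesis
  proof (rule that[of \<epsilon>])
    show "\<epsilon> > 0" using C D by (simp add: \<epsilon>_def)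
    fix \<mu> assume "cmod \<mu> < \<epsilon>"
    then have CD: "(C + D) * cmod \<mu> \<le> 1 / 2" using C D by (simp add: \<epsilon>_def field_simps)
    have "C * cmod \<mu> \<ge> 0" "D * cmod \<mu> \<ge> 0" using C D by auto
    then have C\<mu>: "C * cmod \<mu> \<le> 1" and D\<mu>: "D * cmod \<mu> \<le> 1 / 2"
      using CD unfolding distrib_right by linarith+
    define A where "A = shift S \<mu>"
    have A: "bounded_clinear A" unfolding A_def by (rule bounded_clinear_shift[OF S])
    have SA: "S x = A x + \<mu> *\<^sub>C x" for x by (simp add: A_def shift_def)
    obtain K where K: "K > 0" "\<And>x. norm (A x) \<le> norm x * K"
      using bounded_linear.pos_bounded[OF bounded_clinearD(1)[OF A]] by blast
    \<comment> \<open>The operator induced by the shift modulo \<open>Y\<close> is bounded below.\<close>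
    have dist_bound: "infdist x Y \<le> 2 * D * norm (A x)" if x: "x \<in> V" for x
    proof -
      have "2 * (infdist x Y - D * norm (A x)) \<le> infdist x Y"
      proof (rule le_infdistI[OF ne])
        fix y assume y: "y \<in> Y"
        have "\<mu> *\<^sub>C y \<in> S ` Y" unfolding Y(3) by (rule complex_vector.subspace_scale[OF Y(1) y])
        then obtain u where u: "u \<in> Y" "S u = \<mu> *\<^sub>C y" by (metis imageE)
        have xu: "x - u \<in> V" using x u YV by (intro complex_vector.subspace_diff V) auto
        have Sxu: "S (x - u) = A x + \<mu> *\<^sub>C (x - y)"
          by (simp add: bounded_clinearD[OF S] u SA[of x] complex_vector.scale_right_diff_distrib)
        obtain z where z: "z \<in> V" "S z = S (x - u)" "norm z \<le> D * norm (S (x - u))"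
          using D(2)[of "S (x - u)"] xu by blast
        have "(x - u) - z \<in> V" "S ((x - u) - z) = 0"
          using z(2) complex_vector.subspace_diff[OF V(1) xu z(1)] bounded_clinearD(4)[OF S, of "x - u" z]
          by simp_all
        then have "(x - u) - z \<in> Y" using ker by blast
        then have "((x - u) - z) + u \<in> Y" using u(1) by (rule complex_vector.subspace_add[OF Y(1)])
        then have "x - z \<in> Y" by simp
        then have "infdist x Y \<le> norm z" using infdist_le[of "x - z" Y x] by (simp add: dist_norm)
        also have "\<dots> \<le> D * (norm (A x) + cmod \<mu> * norm (x - y))"
          using z(3) mult_left_mono[OF norm_triangle_ineq[of "A x" "\<mu> *\<^sub>C (x - y)"] D(1)]
          unfolding Sxu norm_scaleC by linarith
        also have "\<dots> = D * norm (A x) + (D * cmod \<mu>) * norm (x - y)" by (simp add: algebra_simps)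
        also have "\<dots> \<le> D * norm (A x) + 1 / 2 * norm (x - y)"
          by (intro add_left_mono mult_right_mono[OF D\<mu>]) simp
        finally show "2 * (infdist x Y - D * norm (A x)) \<le> dist x y" by (simp add: dist_norm)
      qed
      then show ?thesis by simp
    qed
    \<comment> \<open>A point of \<open>Y\<close> at distance less than \<open>2 * infdist x Y\<close> exists unless the distance is \<open>0\<close>.\<close>
    have decomposition: "\<exists>y\<in>Y. norm (x - y) \<le> 4 * D * norm (A x)" if x: "x \<in> V" for x
    proof (cases "infdist x Y = 0")
      case True
      then have "x \<in> Y" using in_closed_iff_infdist_zero[OF Y(2) ne] by blast
      then show ?thesis using D(1) by (intro bexI[of _ x]) auto
    next
      case False
      then have "infdist x Y < 2 * infdist x Y" using infdist_nonneg[of x Y] by simp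
      then obtain y where "y \<in> Y" "dist x y < 2 * infdist x Y"
        using le_infdistI[OF ne, of "2 * infdist x Y" x] by (meson not_le)
      then show ?thesis using dist_bound[OF x] by (intro bexI[of _ y]) (auto simp: dist_norm)
    qed
    have "closed (A ` V)"
    proof (rule closed_image_if_bounded_preimages[OF bounded_clinearD(1)[OF A]
          real_subspace_of_complex[OF V(1)] V(2)])
      show "0 \<le> C * (1 + 4 * D * K) + 4 * D" using C D K by simp
      fix w assume "w \<in> A ` V"
      then obtain x where x: "x \<in> V" "A x = w" by blast
      obtain y where y: "y \<in> Y" "norm (x - y) \<le> 4 * D * norm w"
        using decomposition[OF x(1)] x(2) by blast
      have "S y \<in> Y" using Y(3) y(1) by blast
      then have "A y \<in> Y" unfolding A_def shift_def
        by (intro complex_vector.subspace_diff complex_vector.subspace_scale Y y)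
      then obtain y' where y': "y' \<in> Y" "A y' = A y" "norm y' \<le> C * norm (A y)"
        using C(2)[OF C\<mu>] unfolding A_def by blast
      have "norm (A (x - y)) \<le> (4 * D * norm w) * K"
        using K(2)[of "x - y"] mult_right_mono[OF y(2), of K] K(1) by linarith
      moreover have "norm (A y) \<le> norm w + norm (A (x - y))"
        using norm_triangle_ineq4[of w "A (x - y)"] by (simp add: bounded_clinearD[OF A] x)
      ultimately have "norm (A y) \<le> (1 + 4 * D * K) * norm w" by (simp add: algebra_simps)
      then have ny': "norm y' \<le> C * (1 + 4 * D * K) * norm w"
        using y'(3) mult_left_mono[of "norm (A y)" "(1 + 4 * D * K) * norm w" C] C(1)
        unfolding mult.assoc by linarith
      show "\<exists>x\<in>V. A x = w \<and> norm x \<le> (C * (1 + 4 * D * K) + 4 * D) * norm w"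
      proof (intro bexI conjI)
        show "A (y' + (x - y)) = w" by (simp add: bounded_clinearD[OF A] y' x)
        have "norm (y' + (x - y)) \<le> norm y' + norm (x - y)" by (rule norm_triangle_ineq)
        then show "norm (y' + (x - y)) \<le> (C * (1 + 4 * D * K) + 4 * D) * norm w"
          using ny' y(2) unfolding distrib_right by linarith
        show "y' + (x - y) \<in> V" using y' x y YV
          by (intro complex_vector.subspace_add complex_vector.subspace_diff V) auto
      qed
    qed
    then show "closed (shift S \<mu> ` V)" by (simp add: A_def)
  qed
qed

section \<open>From the range of a power to the whole space\<close>

lemma shift_funpow_commute:
  assumes "bounded_clinear S"
  shows "(S ^^ d) (shift S \<mu> x) = shift S \<mu> ((S ^^ d) x)"
  using bounded_clinearD[OF bounded_clinear_funpow[OF assms, of d]]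
  by (simp add: shift_def funpow_swap1)

text \<open>
  The polynomials \<open>t ^ d\<close> and \<open>t - \<mu>\<close> are coprime; the induction on \<open>d\<close> divides
  \<open>\<mu> *\<^sub>C v = S v - shift S \<mu> v\<close> by \<open>\<mu>\<close>.
\<close>

lemma kernel_funpow_subset_range_shift:
  assumes S: "bounded_clinear S" and \<mu>: "\<mu> \<noteq> 0" and v: "(S ^^ d) v = 0"
  shows "v \<in> range (shift S \<mu>)"
  using v
proof (induction d arbitrary: v)
  case 0
  then have "v = shift S \<mu> 0" by (simp add: bounded_clinearD[OF bounded_clinear_shift[OF S]])
  then show ?case by blast
next
  case (Suc d)
  have sub: "complex_vector.subspace (range (shift S \<mu>))"
    by (intro subspace_range_clinear bounded_clinear_shift S)
  have "S v \<in> range (shift S \<mu>)"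
    using Suc.prems by (intro Suc.IH) (simp add: funpow_swap1)
  then have "S v - shift S \<mu> v \<in> range (shift S \<mu>)"
    by (intro complex_vector.subspace_diff[OF sub]) auto
  then have "\<mu> *\<^sub>C v \<in> range (shift S \<mu>)" by (simp add: shift_def)
  from complex_vector.subspace_scale[OF sub this, of "inverse \<mu>"] \<mu> show ?case by simp
qed

text \<open>
  The range on the whole space is the preimage under \<open>S ^^ d\<close> of the range on \<open>range (S ^^ d)\<close>,
  because the range of \<open>shift S \<mu>\<close> contains the kernel of \<open>S ^^ d\<close>.
\<close>

lemma closed_range_shift_if_closed_on_range_power:
  assumes S: "bounded_clinear S" and \<mu>: "\<mu> \<noteq> 0"
    and cl: "closed (shift S \<mu> ` range (S ^^ d))"
  shows "closed (range (shift S \<mu>))"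
proof -
  have sub: "complex_vector.subspace (range (shift S \<mu>))"
    by (intro subspace_range_clinear bounded_clinear_shift S)
  have "range (shift S \<mu>) = (S ^^ d) -` (shift S \<mu> ` range (S ^^ d))"
  proof
    show "range (shift S \<mu>) \<subseteq> (S ^^ d) -` (shift S \<mu> ` range (S ^^ d))"
      by (auto simp: shift_funpow_commute[OF S])
    show "(S ^^ d) -` (shift S \<mu> ` range (S ^^ d)) \<subseteq> range (shift S \<mu>)"
    proof
      fix y assume "y \<in> (S ^^ d) -` (shift S \<mu> ` range (S ^^ d))"
      then obtain x where x: "(S ^^ d) y = shift S \<mu> ((S ^^ d) x)" by blast
      then have "(S ^^ d) (y - shift S \<mu> x) = 0"
        by (simp add: bounded_clinearD[OF bounded_clinear_funpow[OF S]] shift_funpow_commute[OF S])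
      then have "y - shift S \<mu> x \<in> range (shift S \<mu>)"
        by (rule kernel_funpow_subset_range_shift[OF S \<mu>])
      from complex_vector.subspace_add[OF sub this rangeI[of _ x]] show "y \<in> range (shift S \<mu>)" by simp
    qed
  qed
  moreover have "continuous_on UNIV (S ^^ d)"
    by (rule linear_continuous_on[OF bounded_clinearD(1)[OF bounded_clinear_funpow[OF S]]])
  ultimately show ?thesis using closed_vimage[OF cl] by simp
qed

lemma null_space_shift_subset_hyperrange:
  assumes S: "bounded_clinear S" and \<mu>: "\<mu> \<noteq> 0"
  shows "null_space (shift S \<mu>) \<subseteq> hyperrange S"
proof
  fix x assume "x \<in> null_space (shift S \<mu>)"
  then have x: "S x = \<mu> *\<^sub>C x" by (simp add: null_space_def shift_def)
  have pow: "(S ^^ m) x = \<mu> ^ m *\<^sub>C x" for m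
    by (induction m) (simp_all add: bounded_clinearD[OF S] x mult.commute)
  have "x \<in> range (S ^^ m)" for m
  proof -
    have "(S ^^ m) (inverse (\<mu> ^ m) *\<^sub>C x) = x"
      using \<mu> by (simp add: bounded_clinearD[OF bounded_clinear_funpow[OF S]] pow)
    then show ?thesis by (metis rangeI)
  qed
  then show "x \<in> hyperrange S" by (simp add: hyperrange_def)
qed

section \<open>Ascent and left Drazin invertibility\<close>

lemma null_space_funpow_stable:
  assumes "null_space (S ^^ p) = null_space (S ^^ Suc p)" and "p \<le> m"
  shows "null_space (S ^^ m) = null_space (S ^^ Suc m)"
  using assms(2)
proof (induction rule: dec_induct)
  case (step m)
  have "(S ^^ Suc m) x = 0 \<longleftrightarrow> (S ^^ Suc (Suc m)) x = 0" for x
  proof -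
    have "(S ^^ m) (S x) = 0 \<longleftrightarrow> (S ^^ Suc m) (S x) = 0"
      using step.IH unfolding null_space_def by blast
    then show ?thesis by (simp add: funpow_swap1)
  qed
  then show ?case unfolding null_space_def by blast
qed (rule assms(1))

lemma null_space_funpow_eq_Suc_iff:
  assumes S: "bounded_clinear S"
  shows "null_space (S ^^ m) = null_space (S ^^ Suc m) \<longleftrightarrow> kernel_in_range_power S m = {0}"
proof -
  have "S 0 = 0" "(S ^^ m) 0 = 0"
    using bounded_clinearD(5) S bounded_clinear_funpow by blast+
  then have "0 \<in> kernel_in_range_power S m" by (auto simp: kernel_in_range_power_def image_iff intro!: exI[of _ 0])
  then have "kernel_in_range_power S m = {0} \<longleftrightarrow> (\<forall>x. S ((S ^^ m) x) = 0 \<longrightarrow> (S ^^ m) x = 0)"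
    by (auto simp: kernel_in_range_power_def)
  also have "\<dots> \<longleftrightarrow> null_space (S ^^ m) = null_space (S ^^ Suc m)"
    using \<open>S 0 = 0\<close> by (auto simp: null_space_def set_eq_iff)
  finally show ?thesis by simp
qed

lemma ascent_finite:
  assumes "null_space (S ^^ n) = null_space (S ^^ Suc n)"
  obtains p where "ascent S = enat p"
proof -
  have "ascent S \<le> enat n" unfolding ascent_def by (rule INF_lower) (use assms in blast)
  then show thesis by (cases "ascent S") (use that in auto)
qed

lemma null_space_at_ascent:
  assumes "ascent S = enat p"
  shows "null_space (S ^^ p) = null_space (S ^^ Suc p)"
proof -
  let ?A = "enat ` {n. null_space (S ^^ n) = null_space (S ^^ Suc n)}"
  have "?A \<noteq> {}"
  proof
    assume "?A = {}"
    then have "ascent S = \<infinity>" by (simp only: ascent_def Inf_enat_def) simp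
    then show False using assms by simp
  qed
  then obtain n where "n \<in> ?A" by blast
  then have "Inf ?A \<in> ?A" by (rule wellorder_InfI)
  then have "enat p \<in> ?A" using assms by (simp only: ascent_def)
  then show ?thesis by blast
qed

lemma closed_range_funpow_descend_to:
  assumes S: "bounded_clinear S" and "p \<le> q" "closed (range (S ^^ q))"
    and fin: "\<And>m. p \<le> m \<Longrightarrow> cfinite_dim (kernel_in_range_power S m)"
  shows "closed (range (S ^^ p))"
  using assms(2,3)
proof (induction rule: inc_induct)
  case (step m)
  have "closed (range (S ^^ m))"
    by (rule closed_range_funpow_descend[OF S step.IH[OF step.prems] fin[OF step.hyps(1)]])
  then show ?case .
qed

text \<open>
  The triviality of the intersection makes the ascent finite, but the ascent \<open>p\<close> may be smaller than
  \<open>d\<close>. Closedness therefore has to be carried down to the exponent \<open>Suc p\<close> of the definition.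
\<close>

lemma left_drazin_invertible_if_kernel_meets_range_trivially:
  assumes S: "bounded_clinear S"
    and cl: "\<And>m. d \<le> m \<Longrightarrow> closed (range (S ^^ m))"
    and ker: "kernel_in_range_power S d = {0}"
  shows "left_drazin_invertible S"
proof -
  have "null_space (S ^^ d) = null_space (S ^^ Suc d)"
    by (simp only: null_space_funpow_eq_Suc_iff[OF S] ker)
  then obtain p where p: "ascent S = enat p" by (rule ascent_finite)
  have fin: "cfinite_dim (kernel_in_range_power S m)" if "p \<le> m" for m
  proof -
    have "kernel_in_range_power S m = complex_vector.span {}"
      using null_space_funpow_stable[OF null_space_at_ascent[OF p] that]
        null_space_funpow_eq_Suc_iff[OF S] by simp
    then show ?thesis unfolding cfinite_dim_def by blast
  qed
  have "closed (range (S ^^ Suc p))"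
    by (rule closed_range_funpow_descend_to[OF S, of _ "d + Suc p"]) (simp_all add: cl fin del: funpow.simps)
  then show ?thesis unfolding left_drazin_invertible_def using p by blast
qed

lemma upper_semi_b_fredholm_if_left_drazin_invertible:
  assumes S: "bounded_clinear S" and ld: "left_drazin_invertible S"
  shows "upper_semi_b_fredholm S"
proof -
  obtain p where p: "ascent S = enat p" "closed (range (S ^^ Suc p))"
    using ld by (auto simp: left_drazin_invertible_def)
  have "kernel_in_range_power S p = complex_vector.span {}"
    using null_space_at_ascent[OF p(1)] null_space_funpow_eq_Suc_iff[OF S] by simp
  then have fin: "cfinite_dim (kernel_in_range_power S p)" unfolding cfinite_dim_def by blast
  have clp: "closed (range (S ^^ p))" by (rule closed_range_funpow_descend[OF S p(2) fin])
  moreover have "closedin (top_of_set (range (S ^^ p))) (S ` range (S ^^ p))"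
    using p(2) range_funpow_antimono[of p "Suc p" S]
    unfolding image_range_funpow by (intro closed_subset) auto
  ultimately show ?thesis
    using fin unfolding upper_semi_b_fredholm_def upper_semi_fredholm_on_def kernel_in_range_power_def
    by blast
qed

lemma upper_semi_b_fredholm_if_upper_semi_fredholm:
  "upper_semi_fredholm S \<Longrightarrow> upper_semi_b_fredholm S"
  unfolding upper_semi_b_fredholm_def upper_semi_fredholm_def upper_semi_fredholm_on_def null_space_def
  by (intro exI[of _ 0]) simp

text \<open>
  All traces of the kernel on ranges of powers are finite-dimensional, so closedness descends from a
  high power to \<open>S\<close> itself.
\<close>

lemma upper_semi_fredholm_if_finite_nullity:
  assumes S: "bounded_clinear S" and b: "upper_semi_b_fredholm S" and fin: "cfinite_dim (null_space S)"
  shows "upper_semi_fredholm S"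
proof -
  obtain d where d: "\<And>m. d \<le> m \<Longrightarrow> closed (range (S ^^ m))"
    "\<And>m. d \<le> m \<Longrightarrow> kernel_in_range_power S m = kernel_in_range_power S d"
    "cfinite_dim (kernel_in_range_power S d)"
    by (rule upper_semi_b_fredholm_stable_powers[OF S b]) blast
  have fin': "cfinite_dim (kernel_in_range_power S m)" for m
    by (rule cfinite_dim_subspace[OF subspace_kernel_in_range_power[OF S] _ fin])
      (auto simp: kernel_in_range_power_def null_space_def)
  have "closed (range (S ^^ 1))"
    by (rule closed_range_funpow_descend_to[OF S, of _ "d + 1"]) (simp_all add: d fin' del: funpow.simps)
  then show ?thesis using fin by (simp add: upper_semi_fredholm_def)
qed

section \<open>The punctured neighbourhood dichotomy\<close>

text \<open>
  Either the stable trace of the kernel is \<open>0\<close>, so that the ascent is finite, or it contains a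
  nonzero \<open>k\<close>. In the second case \<open>k\<close> lies in the hyperrange \<open>Y\<close>, on which \<open>S\<close> is surjective, and
  \<open>k\<close> can be continued to eigenvectors for all small \<open>\<mu>\<close>.
\<close>

theorem upper_semi_b_fredholm_dichotomy:
  assumes S: "bounded_clinear S" and b: "upper_semi_b_fredholm S"
  shows "left_drazin_invertible S \<or>
    (\<exists>\<epsilon>>0. \<forall>\<mu>. \<mu> \<noteq> 0 \<longrightarrow> cmod \<mu> < \<epsilon> \<longrightarrow>
      (\<exists>x. x \<noteq> 0 \<and> shift S \<mu> x = 0) \<and> upper_semi_fredholm (shift S \<mu>))"
proof -
  obtain d where d: "\<And>m. d \<le> m \<Longrightarrow> closed (range (S ^^ m))"
    "\<And>m. d \<le> m \<Longrightarrow> kernel_in_range_power S m = kernel_in_range_power S d"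
    "cfinite_dim (kernel_in_range_power S d)"
    by (rule upper_semi_b_fredholm_stable_powers[OF S b]) blast
  define Y where "Y = hyperrange S"
  define V where "V = range (S ^^ d)"
  have Y: "complex_vector.subspace Y" "closed Y" "S ` Y = Y"
    unfolding Y_def
    by (rule subspace_hyperrange[OF S] closed_hyperrange[OF d(1)] image_hyperrange[OF S d(2)]; assumption)+
  have V: "complex_vector.subspace V" "closed V" "closed (S ` V)"
    unfolding V_def image_range_funpow
    by (intro subspace_range_clinear bounded_clinear_funpow S d(1); simp)+
  have YV: "Y \<subseteq> V" by (auto simp: Y_def V_def hyperrange_def)
  have ker: "{x \<in> V. S x = 0} \<subseteq> Y"
    using kernel_subset_hyperrange[OF d(2)] by (auto simp: kernel_in_range_power_def V_def Y_def)
  have kerY: "{x \<in> Y. S x = 0} = kernel_in_range_power S d"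
    using YV ker by (auto simp: kernel_in_range_power_def V_def)
  show ?thesis
  proof (cases "kernel_in_range_power S d = {0}")
    case True
    have "left_drazin_invertible S"
      by (rule left_drazin_invertible_if_kernel_meets_range_trivially[OF S d(1) True])
    then show ?thesis ..
  next
    case False
    have "0 \<in> kernel_in_range_power S d"
      by (rule complex_vector.subspace_0[OF subspace_kernel_in_range_power[OF S]])
    with False kerY obtain k where k: "k \<in> Y" "S k = 0" "k \<noteq> 0" by blast
    obtain C where C: "C > 0"
      "\<And>\<mu> y. C * cmod \<mu> \<le> 1 \<Longrightarrow> y \<in> Y \<Longrightarrow> \<exists>x\<in>Y. shift S \<mu> x = y \<and> norm x \<le> C * norm y"
      by (rule shift_surjective_near_zero[OF S Y]) blast
    obtain \<epsilon>1 where \<epsilon>1: "\<epsilon>1 > 0" "\<And>\<mu>. cmod \<mu> < \<epsilon>1 \<Longrightarrow> cfinite_dim {x \<in> Y. shift S \<mu> x = 0}"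
      by (rule cfinite_dim_shift_kernel_near_zero[OF S Y]) (use d(3) kerY in auto)
    obtain \<epsilon>2 where \<epsilon>2: "\<epsilon>2 > 0" "\<And>\<mu>. cmod \<mu> < \<epsilon>2 \<Longrightarrow> closed (shift S \<mu> ` V)"
      by (rule closed_shift_image_near_zero[OF S Y V YV ker]) blast
    define \<epsilon> where "\<epsilon> = min (1 / C) (min \<epsilon>1 \<epsilon>2)"
    have "\<epsilon> > 0" using C \<epsilon>1 \<epsilon>2 by (simp add: \<epsilon>_def)
    moreover have "(\<exists>x. x \<noteq> 0 \<and> shift S \<mu> x = 0) \<and> upper_semi_fredholm (shift S \<mu>)"
      if \<mu>: "\<mu> \<noteq> 0" "cmod \<mu> < \<epsilon>" for \<mu>
    proof
      have C\<mu>: "C * cmod \<mu> < 1" using \<mu>(2) C(1) by (simp add: \<epsilon>_def field_simps)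
      obtain e where e: "e \<in> Y" "shift S \<mu> e = 0" "norm (e - k) \<le> C * cmod \<mu> * norm k"
        using eigenvector_near_kernel_vector[OF S Y(1) C(2)[OF less_imp_le[OF C\<mu>]] k(1,2)] by blast
      have "e \<noteq> 0"
      proof
        assume "e = 0"
        then have "norm k \<le> C * cmod \<mu> * norm k" using e(3) by simp
        then show False using C\<mu> k(3) by simp
      qed
      then show "\<exists>x. x \<noteq> 0 \<and> shift S \<mu> x = 0" using e(2) by blast
      have "null_space (shift S \<mu>) = {x \<in> Y. shift S \<mu> x = 0}"
        using null_space_shift_subset_hyperrange[OF S \<mu>(1)] by (auto simp: null_space_def Y_def)
      then have "cfinite_dim (null_space (shift S \<mu>))" using \<epsilon>1(2) \<mu>(2) by (simp add: \<epsilon>_def)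
      moreover have "closed (range (shift S \<mu>))"
        using closed_range_shift_if_closed_on_range_power[OF S \<mu>(1), of d] \<epsilon>2(2) \<mu>(2)
        by (simp add: \<epsilon>_def V_def)
      ultimately show "upper_semi_fredholm (shift S \<mu>)" by (simp add: upper_semi_fredholm_def)
    qed
    ultimately show ?thesis by blast
  qed
qed

section \<open>Comparison of the two properties\<close>

lemma point_spectrum_subset_approx:
  assumes T: "bounded_clinear T"
  shows "point_spectrum T \<subseteq> approx_point_spectrum T"
proof
  fix \<mu> assume "\<mu> \<in> point_spectrum T"
  then obtain x where x: "x \<noteq> 0" "T x = \<mu> *\<^sub>C x" by (auto simp: point_spectrum_def)
  define u where "u = complex_of_real (inverse (norm x)) *\<^sub>C x"
  have "norm u = 1" using x(1) by (simp add: u_def norm_scaleC norm_inverse)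
  moreover have "shift T \<mu> u = 0"
    by (simp add: u_def bounded_clinearD(2)[OF bounded_clinear_shift[OF T]]) (simp add: shift_def x)
  ultimately show "\<mu> \<in> approx_point_spectrum T"
    unfolding approx_point_spectrum_def by (intro CollectI exI[of _ "\<lambda>_. u"]) simp
qed

lemma point_spectrum_subset_spectrum:
  "point_spectrum T \<subseteq> spectrum T"
proof
  fix \<mu> assume "\<mu> \<in> point_spectrum T"
  then obtain x where x: "x \<noteq> 0" "shift T \<mu> x = 0" by (auto simp: point_spectrum_def shift_def)
  show "\<mu> \<in> spectrum T"
  proof (rule ccontr)
    assume "\<mu> \<notin> spectrum T"
    then obtain R where R: "bounded_clinear R" "R \<circ> shift T \<mu> = id" by (auto simp: spectrum_def)
    have "x = R (shift T \<mu> x)" using R(2) by (metis comp_apply id_apply)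
    then show False using x bounded_clinearD(5)[OF R(1)] by simp
  qed
qed

lemma left_drazin_or_punctured_disc_of_eigenvalues:
  assumes T: "bounded_clinear T" and l: "l \<notin> usbf_spectrum T"
  shows "l \<notin> left_drazin_spectrum T \<or>
    (\<exists>\<epsilon>>0. ball l \<epsilon> - {l} \<subseteq> point_spectrum T - usf_spectrum T)"
proof -
  have shift_shift: "shift (shift T l) (\<mu> - l) = shift T \<mu>" for \<mu>
    by (auto simp: shift_def complex_vector.scale_left_diff_distrib)
  from upper_semi_b_fredholm_dichotomy[OF bounded_clinear_shift[OF T, of l]] l
  consider "left_drazin_invertible (shift T l)"
    | \<epsilon> where "\<epsilon> > 0" "\<And>\<mu>. \<mu> \<noteq> 0 \<Longrightarrow> cmod \<mu> < \<epsilon> \<Longrightarrow>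
        (\<exists>x. x \<noteq> 0 \<and> shift (shift T l) \<mu> x = 0) \<and> upper_semi_fredholm (shift (shift T l) \<mu>)"
    unfolding usbf_spectrum_def by blast
  then show ?thesis
  proof cases
    case 1
    then show ?thesis by (simp add: left_drazin_spectrum_def)
  next
    case (2 \<epsilon>)
    have "\<mu> \<in> point_spectrum T - usf_spectrum T" if "\<mu> \<in> ball l \<epsilon> - {l}" for \<mu>
    proof -
      have "\<mu> - l \<noteq> 0" "cmod (\<mu> - l) < \<epsilon>" using that by (auto simp: dist_norm norm_minus_commute)
      from 2(2)[OF this] show ?thesis
        unfolding shift_shift point_spectrum_def usf_spectrum_def by (auto simp: shift_def)
    qed
    then show ?thesis using \<open>\<epsilon> > 0\<close> by blast
  qed
qed

lemma not_isolated_if_in_open_subset: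
  assumes "open U" "U \<subseteq> A" "z \<in> U"
  shows "z \<notin> isolated_points_of A"
proof -
  have "z islimpt U" using assms by (simp add: interior_limit_point interior_open)
  then show ?thesis using islimpt_subset[OF _ assms(2)] by (auto simp: isolated_points_of_altdef)
qed

theorem corollary4p5:
  fixes T :: "'a::complex_banach \<Rightarrow> 'a"
  assumes "bounded_clinear T"
  shows "property_gw_pi_00 T \<longleftrightarrow> property_w_pi_00 T \<and> pi_0 T = left_poles T"
proof
  note T = assms
  have bf: "usbf_spectrum T \<subseteq> usf_spectrum T" "usbf_spectrum T \<subseteq> left_drazin_spectrum T"
    unfolding usbf_spectrum_def usf_spectrum_def left_drazin_spectrum_def
    using upper_semi_b_fredholm_if_upper_semi_fredholm
      upper_semi_b_fredholm_if_left_drazin_invertible[OF bounded_clinear_shift[OF T]] by blast+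
  have pi_00: "pi_00 T = pi_0 T \<inter> {\<mu>. cfinite_dim (null_space (shift T \<mu>))}"
    by (auto simp: pi_00_def pi_0_def point_spectrum_finite_def)
  {
    assume "property_gw_pi_00 T"
    then have gw: "approx_point_spectrum T - usbf_spectrum T = pi_0 T"
      by (simp add: property_gw_pi_00_def)
    have "approx_point_spectrum T - usf_spectrum T = pi_00 T"
    proof
      show "approx_point_spectrum T - usf_spectrum T \<subseteq> pi_00 T"
        using gw bf(1) unfolding pi_00 by (auto simp: usf_spectrum_def upper_semi_fredholm_def)
      show "pi_00 T \<subseteq> approx_point_spectrum T - usf_spectrum T"
        using gw upper_semi_fredholm_if_finite_nullity[OF bounded_clinear_shift[OF T]]
        unfolding pi_00 by (auto simp: usf_spectrum_def usbf_spectrum_def)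
    qed
    moreover have "pi_0 T = left_poles T"
    proof
      show "left_poles T \<subseteq> pi_0 T" using gw bf(2) by (auto simp: left_poles_def)
      show "pi_0 T \<subseteq> left_poles T"
      proof
        fix l assume l: "l \<in> pi_0 T"
        have "\<not> ball l \<epsilon> - {l} \<subseteq> point_spectrum T" if "\<epsilon> > 0" for \<epsilon>
        proof
          assume "ball l \<epsilon> - {l} \<subseteq> point_spectrum T"
          moreover have "l \<in> point_spectrum T" using l by (simp add: pi_0_def)
          ultimately have "ball l \<epsilon> \<subseteq> spectrum T" using point_spectrum_subset_spectrum[of T] by blast
          then have "l \<notin> isolated_points_of (spectrum T)"
            using \<open>\<epsilon> > 0\<close> by (intro not_isolated_if_in_open_subset[of "ball l \<epsilon>"]) auto
          then show False using l by (simp add: pi_0_def)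
        qed
        then show "l \<in> left_poles T"
          using left_drazin_or_punctured_disc_of_eigenvalues[OF T, of l] l gw
          unfolding left_poles_def by blast
      qed
    qed
    ultimately show "property_w_pi_00 T \<and> pi_0 T = left_poles T"
      by (simp add: property_w_pi_00_def)
  }
  {
    assume "property_w_pi_00 T \<and> pi_0 T = left_poles T"
    then have w: "approx_point_spectrum T - usf_spectrum T = pi_00 T" and p: "pi_0 T = left_poles T"
      by (simp_all add: property_w_pi_00_def)
    have "\<not> ball l \<epsilon> - {l} \<subseteq> point_spectrum T - usf_spectrum T" if "\<epsilon> > 0" for l \<epsilon>
    proof
      assume sub: "ball l \<epsilon> - {l} \<subseteq> point_spectrum T - usf_spectrum T"
      \<comment> \<open>Any point of the punctured disc would do.\<close>
      define \<mu> where "\<mu> = l + of_real (\<epsilon> / 2)"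
      have \<mu>: "\<mu> \<in> ball l \<epsilon> - {l}" using \<open>\<epsilon> > 0\<close> by (simp add: \<mu>_def dist_norm)
      then have "\<mu> \<in> approx_point_spectrum T - usf_spectrum T"
        using sub point_spectrum_subset_approx[OF T] by blast
      then have "\<mu> \<in> isolated_points_of (spectrum T)" using w by (auto simp: pi_00_def)
      moreover have "\<mu> \<notin> isolated_points_of (spectrum T)"
        using sub point_spectrum_subset_spectrum[of T] \<mu>
        by (intro not_isolated_if_in_open_subset[of "ball l \<epsilon> - {l}"]) auto
      ultimately show False by blast
    qed
    then have "approx_point_spectrum T - usbf_spectrum T = left_poles T"
      using left_drazin_or_punctured_disc_of_eigenvalues[OF T] bf(2)
      unfolding left_poles_def by blast
    then show "property_gw_pi_00 T" using p by (simp add: property_gw_pi_00_def)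
  }
qed

end
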